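(* For $\boldsymbol o=(o_1,o_2)\in\mathbb{N}^2$ write $\tilde{\boldsymbol o}=(o_2,o_1)$. 1) Consider an $SE(3)\times SE(3)$-transformer layer (defined in the context). If the self-interaction weights satisfy $W^{\boldsymbol o}=W^{\tilde{\boldsymbol o}}$, the query weights satisfy $W_Q^{\boldsymbol o}=W_Q^{\tilde{\boldsymbol o}}$, and the radial functions (of both the key and the value kernels) satisfy $$\varphi^{\boldsymbol o,\boldsymbol i}_{J_1,J_2}(\|z^1\|,\|z^2\|)=\varphi^{\tilde{\boldsymbol o},\tilde{\boldsymbol i}}_{J_2,J_1}(\|z^2\|,\|z^1\|)$$ for all $\boldsymbol i,\boldsymbol o,J_1,J_2$ and all $z^1,z^2\in\mathbb{R}^3$ (all these equalities channel by channel), then the transformer layer is $\mathbb{Z}/2\mathbb{Z}$-equivariant: denoting the layer by $\mathcal{L}$, $\mathcal{L}(s(f))=s(\mathcal{L}(f))$ for every input field $f$. 2) Consider an Elu layer (defined in the context). If $W_\nu^{\boldsymbol i}=W_\nu^{\tilde{\boldsymbol i}}$ and $W_\mu^{\boldsymbol i}=W_\mu^{\tilde{\boldsymbol i}}$ for all $\boldsymbol i$, then the Elu layer is $\mathbb{Z}/2\mathbb{Z}$-equivariant, i.e. it commutes with $s$.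
   Context: **Conventions.** $\|\cdot\|$ is the Euclidean norm, $\oplus$ is concatenation, $\otimes$ is the Kronecker product, $\mathrm{vec}$ stacks the columns of a matrix. **Representations.** $\rho_p$ ($p\in\mathbb{N}$) is the real orthogonal irreducible representation of $SO(3)$ of dimension $2p+1$. $Y_J$ is the vector of real spherical harmonics of degree $J$, so $Y_J(rx)=\rho_J(r)Y_J(x)$ for $\|x\|=1$; by convention $Y_J(x/\|x\|)$ for $x=0$ means $0$ if $J>0$ and the constant $Y_0$ if $J=0$. For $|i-o|\le J\le i+o$, $C_J^{i,o}\in\mathbb{R}^{(2i+1)(2o+1)\times(2J+1)}$ is a fixed real Clebsch–Gordan matrix: $(\rho_i(r)\otimes\rho_o(r))C_J^{i,o}=C_J^{i,o}\rho_J(r)$, with entries $\langle i,m,o,m'|J,m''\rangle$. For $\boldsymbol o=(o_1,o_2)$, $\boldsymbol i=(i_1,i_2)\in\mathbb{N}^2$, the second-order Clebsch–Gordan matrix $\mathcal{Q}^{\boldsymbol o,\boldsymbol i}_{J_1,J_2}$ has rows indexed by $(m_1,m_2,m_3,m_4)$, columns by $(m_5,m_6)$, and entries $\langle i_1,m_1,o_1,m_3|J_1,m_5\rangle\langle i_2,m_2,o_2,m_4|J_2,m_6\rangle$. **6-D tensor fields.** A field $f$ is a finite indexed family of points $z_u\in\mathbb{R}^6$, $u=1,\dots,L$, with features $f^{\boldsymbol i,b}(z_u)\in\mathbb{R}^{(2i_1+1)(2i_2+1)}\cong\mathbb{R}^{2i_1+1}\otimes\mathbb{R}^{2i_2+1}$,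 $\boldsymbol i$ ranging over a finite set of degrees in $\mathbb{N}^2$ and $b$ over channels. The degree sets (of inputs and outputs) are closed under $\boldsymbol i\mapsto\tilde{\boldsymbol i}$, with equally many channels in degrees $\boldsymbol i$ and $\tilde{\boldsymbol i}$. $F^{\boldsymbol i}(z_u)$ is the matrix whose rows are the channels $f^{\boldsymbol i,b}(z_u)$. Write $z=z^1\oplus z^2$ with $z^1,z^2\in\mathbb{R}^3$. A degree-$(p,q)$ feature is also regarded as a $(2p+1)\times(2q+1)$ matrix. **Action of $\mathbb{Z}/2\mathbb{Z}=\{1,s\}$.** On points, $s(z^1\oplus z^2)=z^2\oplus z^1$. On fields, channel by channel, $(s(f))^{p,q}(z)=\bigl(f^{q,p}(s(z))\bigr)^T$; that is, $s(f)$ is supported on the points $s(z_u)$ and its degree-$(p,q)$ feature there is the transpose of $f^{q,p}(z_u)$. **$SE(3)\times SE(3)$-transformer layer.** It keeps the points $z_u$ and sends $f_{in}$ to $f_{out}$, where for each output degree $\boldsymbol o$ and output channel $a$ $$f_{out}^{\boldsymbol o,a}(z_u)=W^{\boldsymbol o,a}F_{in}^{\boldsymbol o}(z_u)+\sum_{v\in KNN(u)\setminus\{u\}}\alpha_{uv}\sum_{\boldsymbol i,b}\mathcal{W}_V^{\boldsymbol o,\boldsymbol i,a,b}(z_v-z_u)f_{in}^{\boldsymbol i,b}(z_v),$$ the first term being absent if $f_{in}$ has no degree-$\boldsymbol o$ feature. $W^{\boldsymbol o,a}$ is a row vector of (self-interaction) weights. $KNN(u)$ is the set of indices of the $k$ nearest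 points to $z_u$ in Euclidean distance of $\mathbb{R}^6$, ties broken by index. The attention is $\alpha_{uv}=\exp(\mathbf{Q}_u^\top\mathbf{K}_{uv})/\sum_{v'\in KNN(u)\setminus\{u\}}\exp(\mathbf{Q}_u^\top\mathbf{K}_{uv'})$, with query $\mathbf{Q}_u=\bigoplus_{\boldsymbol o}W_Q^{\boldsymbol o}F_{in}^{\boldsymbol o}(z_u)$ and key $\mathbf{K}_{uv}=\bigoplus_{\boldsymbol o}\sum_{\boldsymbol i,b}\mathcal{W}_K^{\boldsymbol o,\boldsymbol i,b}(z_v-z_u)f_{in}^{\boldsymbol i,b}(z_v)$, $\boldsymbol o$ ranging over the input degrees and $W_Q^{\boldsymbol o}$ a row vector of weights. Every kernel ($\mathcal{W}_K$ or $\mathcal{W}_V$, each channel index) is a $(2o_1+1)(2o_2+1)\times(2i_1+1)(2i_2+1)$ matrix of the form $$\mathrm{vec}(\mathcal{W}^{\boldsymbol o,\boldsymbol i}(z))=\sum_{J_1=|o_1-i_1|}^{o_1+i_1}\ \sum_{J_2=|o_2-i_2|}^{o_2+i_2}\varphi^{\boldsymbol o,\boldsymbol i}_{J_1,J_2}(\|z^1\|,\|z^2\|)\,\mathcal{Q}^{\boldsymbol o,\boldsymbol i}_{J_1,J_2}\Bigl(Y_{J_1}\bigl(\tfrac{z^1}{\|z^1\|}\bigr)\otimes Y_{J_2}\bigl(\tfrac{z^2}{\|z^2\|}\bigr)\Bigr),$$ with radial functions $\varphi:\mathbb{R}\times\mathbb{R}\to\mathbb{R}$ (one for each kernel, channel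 index and $J_1,J_2$). **Elu layer.** Pointwise, on each degree $\boldsymbol i$ with $c$ channels: $F_\mu=W_\mu^{\boldsymbol i}F^{\boldsymbol i}$, $F_\nu=W_\nu^{\boldsymbol i}F^{\boldsymbol i}$ with $W_\mu^{\boldsymbol i},W_\nu^{\boldsymbol i}\in\mathbb{R}^{c\times c}$; each output channel equals $F_\mu$ if $\langle F_\mu,F_\nu\rangle\ge 0$ and $F_\mu-\langle F_\mu,\frac{F_\nu}{\|F_\nu\|}\rangle\frac{F_\nu}{\|F_\nu\|}$ otherwise (inner product and norm taken channel by channel). *)

theory Defs
  imports
    "HOL-Analysis.Analysis"
    "HOL-Library.Nat_Bijection"
    "Jordan_Normal_Form.Matrix"
begin

text \<open>
  Features, weights and kernels have dimensions depending on degrees, so they live in the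
  carrier-based types of \<^theory>\<open>Jordan_Normal_Form.Matrix\<close>.  The type-indexed vectors
  of \<^theory>\<open>HOL-Analysis.Finite_Cartesian_Product\<close> serve only for points of 3-space and
  rotations.  All indices of vectors and matrices start at 0, and every multi-index
  \<open>(m\<^sub>1, m\<^sub>2, \<dots>)\<close> is encoded lexicographically (the last entry varies fastest).
\<close>

unbundle no vec_syntax and no inner_syntax
hide_type (open) Finite_Cartesian_Product.vec
hide_const (open)
  Finite_Cartesian_Product.vec Finite_Cartesian_Product.mat Finite_Cartesian_Product.row
  Finite_Cartesian_Product.rows Finite_Cartesian_Product.transpose

abbreviation irr_dim :: "nat \<Rightarrow> nat" where
  "irr_dim p \<equiv> 2 * p + 1"

definition SO3 :: "(real^3^3) set" where
  "SO3 = {r. rotation_matrix r}"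


subsection \<open>Linear algebra\<close>

definition kron_mat :: "real mat \<Rightarrow> real mat \<Rightarrow> real mat" where
  "kron_mat A B = mat (dim_row A * dim_row B) (dim_col A * dim_col B)
     (\<lambda>(r, c). A $$ (r div dim_row B, c div dim_col B) * B $$ (r mod dim_row B, c mod dim_col B))"

definition kron_vec :: "real vec \<Rightarrow> real vec \<Rightarrow> real vec" where
  "kron_vec x y = vec (dim_vec x * dim_vec y) (\<lambda>k. x $ (k div dim_vec y) * y $ (k mod dim_vec y))"

definition stack_cols :: "real mat \<Rightarrow> real vec" where
  "stack_cols M = vec (dim_row M * dim_col M) (\<lambda>k. M $$ (k mod dim_row M, k div dim_row M))"

definition unstack_cols :: "nat \<Rightarrow> nat \<Rightarrow> real vec \<Rightarrow> real mat" where
  "unstack_cols nr nc v = mat nr nc (\<lambda>(r, c). v $ (c * nr + r))"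

definition concat_vecs :: "real vec list \<Rightarrow> real vec" where
  "concat_vecs vs = foldr (@\<^sub>v) vs vNil"

definition vec_mat_mult :: "real vec \<Rightarrow> real mat \<Rightarrow> real vec" where
  "vec_mat_mult w F = vec (dim_col F) (\<lambda>k. w \<bullet> col F k)"

definition vec_norm :: "real vec \<Rightarrow> real" where
  "vec_norm v = sqrt (v \<bullet> v)"


subsection \<open>Representations of SO(3), spherical harmonics, Clebsch-Gordan matrices\<close>

definition SO3_orthogonal_irrep :: "nat \<Rightarrow> (real^3^3 \<Rightarrow> real mat) \<Rightarrow> bool" where
  "SO3_orthogonal_irrep n \<rho> \<longleftrightarrow>
     (\<forall>r\<in>SO3. \<rho> r \<in> carrier_mat n n \<and> \<rho> r * transpose_mat (\<rho> r) = 1\<^sub>m n) \<and>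
     (\<forall>r\<in>SO3. \<forall>r'\<in>SO3. \<rho> (r ** r') = \<rho> r * \<rho> r') \<and>
     (\<forall>k<n. \<forall>l<n. continuous_on SO3 (\<lambda>r. \<rho> r $$ (k, l))) \<and>
     (\<forall>V. V \<subseteq> carrier_vec n \<and> 0\<^sub>v n \<in> V \<and> (\<forall>v\<in>V. \<forall>w\<in>V. v + w \<in> V) \<and>
          (\<forall>a. \<forall>v\<in>V. a \<cdot>\<^sub>v v \<in> V) \<and> (\<forall>r\<in>SO3. \<forall>v\<in>V. \<rho> r *\<^sub>v v \<in> V)
        \<longrightarrow> V = {0\<^sub>v n} \<or> V = carrier_vec n)"

definition SO3_irreps :: "(nat \<Rightarrow> real^3^3 \<Rightarrow> real mat) \<Rightarrow> bool" where
  "SO3_irreps \<rho> \<longleftrightarrow> (\<forall>p. SO3_orthogonal_irrep (irr_dim p) (\<rho> p))"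

definition laplacian :: "(real^3 \<Rightarrow> real) \<Rightarrow> real^3 \<Rightarrow> real" where
  "laplacian h x = (\<Sum>b\<in>Basis. (deriv ^^ 2) (\<lambda>t. h (x + t *\<^sub>R b)) 0)"

definition spherical_harmonic :: "nat \<Rightarrow> (real^3 \<Rightarrow> real) \<Rightarrow> bool" where
  "spherical_harmonic J y \<longleftrightarrow>
     (\<exists>h. real_polynomial_function h \<and> (\<forall>c x. h (c *\<^sub>R x) = c ^ J * h x) \<and>
          (\<forall>x. laplacian h x = 0) \<and> (\<forall>x. norm x = 1 \<longrightarrow> y x = h x))"

text \<open>
  The space of spherical harmonics of degree \<open>J\<close> has dimension \<open>2J + 1\<close>, so the components of
  \<open>Y J\<close> are required to be a basis of it.  By Schur's lemma equivariance under the orthogonal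
  \<open>\<rho> J\<close> makes them \<open>L\<^sup>2\<close>-orthogonal with a common norm; the value of this norm
  is a matter of convention and is left open.
\<close>

definition spherical_harmonics ::
  "(nat \<Rightarrow> real^3^3 \<Rightarrow> real mat) \<Rightarrow> (nat \<Rightarrow> real^3 \<Rightarrow> real vec) \<Rightarrow> bool" where
  "spherical_harmonics \<rho> Y \<longleftrightarrow>
     (\<forall>J. (\<forall>x. norm x = 1 \<longrightarrow> Y J x \<in> carrier_vec (irr_dim J)) \<and>
          (\<forall>m<irr_dim J. spherical_harmonic J (\<lambda>x. Y J x $ m)) \<and>
          (\<forall>c\<in>carrier_vec (irr_dim J).
             (\<forall>x. norm x = 1 \<longrightarrow> c \<bullet> Y J x = 0) \<longrightarrow> c = 0\<^sub>v (irr_dim J)) \<and>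
          (\<forall>r\<in>SO3. \<forall>x. norm x = 1 \<longrightarrow> Y J (r *v x) = \<rho> J r *\<^sub>v Y J x))"

definition cg_range :: "nat \<Rightarrow> nat \<Rightarrow> nat set" where
  "cg_range i j = {nat \<bar>int i - int j\<bar>..i + j}"

text \<open>
  \<open>C J i j\<close> intertwines \<open>\<rho> J\<close> with \<open>\<rho> i \<otimes> \<rho> j\<close>; its
  entry \<open>\<langle>i, m, j, m' | J, m''\<rangle>\<close> is in row \<open>(m, m')\<close> and column
  \<open>m''\<close>.  A nonzero intertwiner is unique up to a scalar, and the normalization is
  again left open.
\<close>

definition clebsch_gordan ::
  "(nat \<Rightarrow> real^3^3 \<Rightarrow> real mat) \<Rightarrow> (nat \<Rightarrow> nat \<Rightarrow> nat \<Rightarrow> real mat) \<Rightarrow> bool" where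
  "clebsch_gordan \<rho> C \<longleftrightarrow>
     (\<forall>i j. \<forall>J\<in>cg_range i j.
        C J i j \<in> carrier_mat (irr_dim i * irr_dim j) (irr_dim J) \<and>
        C J i j \<noteq> 0\<^sub>m (irr_dim i * irr_dim j) (irr_dim J) \<and>
        (\<forall>r\<in>SO3. kron_mat (\<rho> i r) (\<rho> j r) * C J i j = C J i j * \<rho> J r))"

definition cg_coeff ::
  "(nat \<Rightarrow> nat \<Rightarrow> nat \<Rightarrow> real mat) \<Rightarrow> nat \<Rightarrow> nat \<Rightarrow> nat \<Rightarrow> nat \<Rightarrow> nat \<Rightarrow> nat \<Rightarrow> real" where
  "cg_coeff C i m j m' J m'' = C J i j $$ (m * irr_dim j + m', m'')"

text \<open>\<open>Y\<^sub>J(x / \<parallel>x\<parallel>)\<close>, with the convention for \<open>x = 0\<close>; \<open>Y\<^sub>0\<close> is constant on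
  the sphere, so it may be evaluated at any unit vector.\<close>

definition Y_dir :: "(nat \<Rightarrow> real^3 \<Rightarrow> real vec) \<Rightarrow> nat \<Rightarrow> real^3 \<Rightarrow> real vec" where
  "Y_dir Y J x =
     (if x \<noteq> 0 then Y J (x /\<^sub>R norm x)
      else if J = 0 then Y 0 (axis 1 1) else 0\<^sub>v (irr_dim J))"


subsection \<open>6-D tensor fields\<close>

text \<open>The product norm on pairs is the Euclidean norm of the 6-dimensional space.\<close>

type_synonym point6 = "(real^3) \<times> (real^3)"

type_synonym degree = "nat \<times> nat"

abbreviation feat_dim :: "degree \<Rightarrow> nat" where
  "feat_dim \<iota> \<equiv> irr_dim (fst \<iota>) * irr_dim (snd \<iota>)"

text \<open>
  The degrees of a field and their channels are given by a function \<open>c\<close> from degrees to numbers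
  of channels; the degree set consists of the degrees with at least one channel.  Closure of
  the degree set under \<^const>\<open>prod.swap\<close>, and equality of channel numbers, is
  then a single condition.
\<close>

definition degs :: "(degree \<Rightarrow> nat) \<Rightarrow> degree set" where
  "degs c = {\<iota>. 0 < c \<iota>}"

definition channel_type :: "(degree \<Rightarrow> nat) \<Rightarrow> bool" where
  "channel_type c \<longleftrightarrow> finite (degs c) \<and> (\<forall>\<iota>. c (prod.swap \<iota>) = c \<iota>)"

text \<open>
  A field is the list of its points, each with the matrices \<open>F\<^sup>\<iota>\<close> whose rows are the
  channels of degree \<open>\<iota>\<close>.  In degrees outside the degree set this is the unique matrix
  without rows, hence equality of fields is HOL equality.
\<close>

type_synonym tensor_field = "(point6 \<times> (degree \<Rightarrow> real mat)) list"

definition tensor_fields :: "(degree \<Rightarrow> nat) \<Rightarrow> tensor_field set" where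
  "tensor_fields c = {f. \<forall>(z, F)\<in>set f. \<forall>\<iota>. F \<iota> \<in> carrier_mat (c \<iota>) (feat_dim \<iota>)}"

definition pt :: "tensor_field \<Rightarrow> nat \<Rightarrow> point6" where
  "pt f u = fst (f ! u)"

definition feats :: "tensor_field \<Rightarrow> nat \<Rightarrow> degree \<Rightarrow> real mat" where
  "feats f u = snd (f ! u)"

definition feat_to_mat :: "degree \<Rightarrow> real vec \<Rightarrow> real mat" where
  "feat_to_mat \<iota> v =
     mat (irr_dim (fst \<iota>)) (irr_dim (snd \<iota>)) (\<lambda>(m, m'). v $ (m * irr_dim (snd \<iota>) + m'))"

definition mat_to_feat :: "real mat \<Rightarrow> real vec" where
  "mat_to_feat M = vec (dim_row M * dim_col M) (\<lambda>k. M $$ (k div dim_col M, k mod dim_col M))"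

definition swap_field :: "tensor_field \<Rightarrow> tensor_field" where
  "swap_field f =
     map (\<lambda>(z, F). (prod.swap z,
       \<lambda>\<iota>. mat_of_rows (feat_dim \<iota>)
              (map (\<lambda>v. mat_to_feat (transpose_mat (feat_to_mat (prod.swap \<iota>) v)))
                (rows (F (prod.swap \<iota>)))))) f"


subsection \<open>Kernels\<close>

text \<open>Row \<open>(m\<^sub>1, m\<^sub>2, m\<^sub>3, m\<^sub>4)\<close> ranges over (input, output) indices, column
  \<open>(m\<^sub>5, m\<^sub>6)\<close> over the indices of the two spherical harmonics.\<close>

definition cg2 ::
  "(nat \<Rightarrow> nat \<Rightarrow> nat \<Rightarrow> real mat) \<Rightarrow> degree \<Rightarrow> degree \<Rightarrow> nat \<Rightarrow> nat \<Rightarrow> real mat" where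
  "cg2 C \<omega> \<iota> J\<^sub>1 J\<^sub>2 =
     (let i\<^sub>1 = fst \<iota>; i\<^sub>2 = snd \<iota>; o\<^sub>1 = fst \<omega>; o\<^sub>2 = snd \<omega> in
      mat (feat_dim \<iota> * feat_dim \<omega>) (irr_dim J\<^sub>1 * irr_dim J\<^sub>2)
        (\<lambda>(r, c).
           let m\<^sub>1 = r div feat_dim \<omega> div irr_dim i\<^sub>2; m\<^sub>2 = r div feat_dim \<omega> mod irr_dim i\<^sub>2;
               m\<^sub>3 = r mod feat_dim \<omega> div irr_dim o\<^sub>2; m\<^sub>4 = r mod feat_dim \<omega> mod irr_dim o\<^sub>2;
               m\<^sub>5 = c div irr_dim J\<^sub>2; m\<^sub>6 = c mod irr_dim J\<^sub>2
           in cg_coeff C i\<^sub>1 m\<^sub>1 o\<^sub>1 m\<^sub>3 J\<^sub>1 m\<^sub>5 * cg_coeff C i\<^sub>2 m\<^sub>2 o\<^sub>2 m\<^sub>4 J\<^sub>2 m\<^sub>6))"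

definition kernel_vec ::
  "(nat \<Rightarrow> real^3 \<Rightarrow> real vec) \<Rightarrow> (nat \<Rightarrow> nat \<Rightarrow> nat \<Rightarrow> real mat) \<Rightarrow>
   (nat \<Rightarrow> nat \<Rightarrow> real \<Rightarrow> real \<Rightarrow> real) \<Rightarrow> degree \<Rightarrow> degree \<Rightarrow> point6 \<Rightarrow> real vec" where
  "kernel_vec Y C \<phi> \<omega> \<iota> z =
     finsum_vec TYPE(real) (feat_dim \<omega> * feat_dim \<iota>)
       (\<lambda>(J\<^sub>1, J\<^sub>2). \<phi> J\<^sub>1 J\<^sub>2 (norm (fst z)) (norm (snd z)) \<cdot>\<^sub>v
          (cg2 C \<omega> \<iota> J\<^sub>1 J\<^sub>2 *\<^sub>v kron_vec (Y_dir Y J\<^sub>1 (fst z)) (Y_dir Y J\<^sub>2 (snd z))))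
       (cg_range (fst \<omega>) (fst \<iota>) \<times> cg_range (snd \<omega>) (snd \<iota>))"

definition kernel ::
  "(nat \<Rightarrow> real^3 \<Rightarrow> real vec) \<Rightarrow> (nat \<Rightarrow> nat \<Rightarrow> nat \<Rightarrow> real mat) \<Rightarrow>
   (nat \<Rightarrow> nat \<Rightarrow> real \<Rightarrow> real \<Rightarrow> real) \<Rightarrow> degree \<Rightarrow> degree \<Rightarrow> point6 \<Rightarrow> real mat" where
  "kernel Y C \<phi> \<omega> \<iota> z = unstack_cols (feat_dim \<omega>) (feat_dim \<iota>) (kernel_vec Y C \<phi> \<omega> \<iota> z)"

lemma stack_cols_unstack_cols:
  assumes "v \<in> carrier_vec (nr * nc)"
  shows "stack_cols (unstack_cols nr nc v) = v"
proof (rule eq_vecI)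
  show "dim_vec (stack_cols (unstack_cols nr nc v)) = dim_vec v"
    using assms unfolding stack_cols_def unstack_cols_def by simp
  fix k assume "k < dim_vec v"
  then have k: "k < nr * nc" using assms by simp
  then have "0 < nr" by (cases nr) simp_all
  then have "k mod nr < nr" by simp
  moreover have "k div nr < nc"
    using k by (metis less_mult_imp_div_less mult.commute)
  moreover have "k div nr * nr + k mod nr = k" by (rule div_mult_mod_eq)
  ultimately show "stack_cols (unstack_cols nr nc v) $ k = v $ k"
    using k unfolding stack_cols_def unstack_cols_def by simp
qed

lemma stack_cols_kernel: "stack_cols (kernel Y C \<phi> \<omega> \<iota> z) = kernel_vec Y C \<phi> \<omega> \<iota> z"
proof -
  have dim: "dim_row (cg2 C \<omega> \<iota> J\<^sub>1 J\<^sub>2) = feat_dim \<omega> * feat_dim \<iota>" for J\<^sub>1 J\<^sub>2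
    unfolding cg2_def Let_def dim_row_mat by (rule mult.commute)
  have "kernel_vec Y C \<phi> \<omega> \<iota> z \<in> carrier_vec (feat_dim \<omega> * feat_dim \<iota>)"
    unfolding kernel_vec_def
    by (rule finsum_vec_closed)
      (simp only: Pi_iff split: prod.split, simp only: carrier_vec_def mem_Collect_eq
        index_smult_vec dim_mult_mat_vec dim Ball_def simp_thms)
  then show ?thesis
    unfolding kernel_def by (rule stack_cols_unstack_cols)
qed


subsection \<open>The transformer layer\<close>

text \<open>\<^term>\<open>sort_key\<close> is stable, so ties are broken by index.\<close>

definition knn :: "nat \<Rightarrow> tensor_field \<Rightarrow> nat \<Rightarrow> nat set" where
  "knn k f u = set (take k (sort_key (\<lambda>v. dist (pt f u) (pt f v)) [0..<length f]))"

text \<open>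
  \<open>self_wt \<omega>\<close> has the row vectors \<open>W\<^sup>\<omega>\<^sup>,\<^sup>a\<close> as rows.  The radial functions take
  the arguments \<open>\<omega> \<iota> b J\<^sub>1 J\<^sub>2\<close> (keys) and \<open>\<omega> \<iota> a b J\<^sub>1 J\<^sub>2\<close>
  (values), with \<open>\<omega>\<close> and \<open>\<iota>\<close> the row and column degrees of the kernel,
  \<open>a\<close> the output and \<open>b\<close> the input channel.
\<close>

record transformer =
  in_ch :: "degree \<Rightarrow> nat"
  out_ch :: "degree \<Rightarrow> nat"
  num_nbrs :: nat
  self_wt :: "degree \<Rightarrow> real mat"
  query_wt :: "degree \<Rightarrow> real vec"
  key_rad :: "degree \<Rightarrow> degree \<Rightarrow> nat \<Rightarrow> nat \<Rightarrow> nat \<Rightarrow> real \<Rightarrow> real \<Rightarrow> real"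
  val_rad :: "degree \<Rightarrow> degree \<Rightarrow> nat \<Rightarrow> nat \<Rightarrow> nat \<Rightarrow> nat \<Rightarrow> real \<Rightarrow> real \<Rightarrow> real"

definition transformer_layer :: "transformer \<Rightarrow> bool" where
  "transformer_layer T \<longleftrightarrow>
     channel_type (in_ch T) \<and> channel_type (out_ch T) \<and>
     (\<forall>\<omega>\<in>degs (in_ch T) \<inter> degs (out_ch T).
        self_wt T \<omega> \<in> carrier_mat (out_ch T \<omega>) (in_ch T \<omega>)) \<and>
     (\<forall>\<omega>\<in>degs (in_ch T). query_wt T \<omega> \<in> carrier_vec (in_ch T \<omega>))"

definition in_feat_sum ::
  "transformer \<Rightarrow> degree \<Rightarrow> (degree \<Rightarrow> nat \<Rightarrow> real mat) \<Rightarrow> tensor_field \<Rightarrow> nat \<Rightarrow> real vec" where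
  "in_feat_sum T \<omega> K f v =
     finsum_vec TYPE(real) (feat_dim \<omega>) (\<lambda>(\<iota>, b). K \<iota> b *\<^sub>v row (feats f v \<iota>) b)
       (SIGMA \<iota>:degs (in_ch T). {..<in_ch T \<iota>})"

text \<open>A fixed enumeration of the input degrees, giving the order of concatenation in both
  queries and keys.\<close>

definition in_deg_list :: "transformer \<Rightarrow> degree list" where
  "in_deg_list T = map prod_decode (sorted_list_of_set (prod_encode ` degs (in_ch T)))"

definition query :: "transformer \<Rightarrow> tensor_field \<Rightarrow> nat \<Rightarrow> real vec" where
  "query T f u = concat_vecs (map (\<lambda>\<omega>. vec_mat_mult (query_wt T \<omega>) (feats f u \<omega>)) (in_deg_list T))"

definition key ::
  "(nat \<Rightarrow> real^3 \<Rightarrow> real vec) \<Rightarrow> (nat \<Rightarrow> nat \<Rightarrow> nat \<Rightarrow> real mat) \<Rightarrow>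
   transformer \<Rightarrow> tensor_field \<Rightarrow> nat \<Rightarrow> nat \<Rightarrow> real vec" where
  "key Y C T f u v = concat_vecs
     (map (\<lambda>\<omega>. in_feat_sum T \<omega> (\<lambda>\<iota> b. kernel Y C (key_rad T \<omega> \<iota> b) \<omega> \<iota> (pt f v - pt f u)) f v)
       (in_deg_list T))"

definition attention ::
  "(nat \<Rightarrow> real^3 \<Rightarrow> real vec) \<Rightarrow> (nat \<Rightarrow> nat \<Rightarrow> nat \<Rightarrow> real mat) \<Rightarrow>
   transformer \<Rightarrow> tensor_field \<Rightarrow> nat \<Rightarrow> nat \<Rightarrow> real" where
  "attention Y C T f u v =
     exp (query T f u \<bullet> key Y C T f u v) /
     (\<Sum>v'\<in>knn (num_nbrs T) f u - {u}. exp (query T f u \<bullet> key Y C T f u v'))"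

definition out_feat ::
  "(nat \<Rightarrow> real^3 \<Rightarrow> real vec) \<Rightarrow> (nat \<Rightarrow> nat \<Rightarrow> nat \<Rightarrow> real mat) \<Rightarrow>
   transformer \<Rightarrow> tensor_field \<Rightarrow> nat \<Rightarrow> degree \<Rightarrow> nat \<Rightarrow> real vec" where
  "out_feat Y C T f u \<omega> a =
     (if \<omega> \<in> degs (in_ch T) then vec_mat_mult (row (self_wt T \<omega>) a) (feats f u \<omega>)
      else 0\<^sub>v (feat_dim \<omega>)) +
     finsum_vec TYPE(real) (feat_dim \<omega>)
       (\<lambda>v. attention Y C T f u v \<cdot>\<^sub>v
          in_feat_sum T \<omega> (\<lambda>\<iota> b. kernel Y C (val_rad T \<omega> \<iota> a b) \<omega> \<iota> (pt f v - pt f u)) f v)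
       (knn (num_nbrs T) f u - {u})"

definition apply_transformer ::
  "(nat \<Rightarrow> real^3 \<Rightarrow> real vec) \<Rightarrow> (nat \<Rightarrow> nat \<Rightarrow> nat \<Rightarrow> real mat) \<Rightarrow>
   transformer \<Rightarrow> tensor_field \<Rightarrow> tensor_field" where
  "apply_transformer Y C T f =
     map (\<lambda>u. (pt f u,
       \<lambda>\<omega>. mat_of_rows (feat_dim \<omega>) (map (out_feat Y C T f u \<omega>) [0..<out_ch T \<omega>])))
       [0..<length f]"


subsection \<open>The Elu layer\<close>

record elu =
  elu_ch :: "degree \<Rightarrow> nat"
  mu_wt :: "degree \<Rightarrow> real mat"
  nu_wt :: "degree \<Rightarrow> real mat"

definition elu_layer :: "elu \<Rightarrow> bool" where
  "elu_layer E \<longleftrightarrow> channel_type (elu_ch E) \<and>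
     (\<forall>\<iota>\<in>degs (elu_ch E). mu_wt E \<iota> \<in> carrier_mat (elu_ch E \<iota>) (elu_ch E \<iota>) \<and>
                              nu_wt E \<iota> \<in> carrier_mat (elu_ch E \<iota>) (elu_ch E \<iota>))"

definition elu_channel :: "real vec \<Rightarrow> real vec \<Rightarrow> real vec" where
  "elu_channel \<mu> \<nu> =
     (if \<mu> \<bullet> \<nu> \<ge> 0 then \<mu>
      else let n = (1 / vec_norm \<nu>) \<cdot>\<^sub>v \<nu> in \<mu> - (\<mu> \<bullet> n) \<cdot>\<^sub>v n)"

definition apply_elu :: "elu \<Rightarrow> tensor_field \<Rightarrow> tensor_field" where
  "apply_elu E f =
     map (\<lambda>(z, F). (z, \<lambda>\<iota>. mat_of_rows (feat_dim \<iota>)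
       (map (\<lambda>a. elu_channel (row (mu_wt E \<iota> * F \<iota>) a) (row (nu_wt E \<iota> * F \<iota>) a))
         [0..<elu_ch E \<iota>]))) f"

end

theory Submission
  imports Defs
begin

text \<open>
  Transposing features is a fixed permutation of coordinates, hence linear and an isometry.
  It exchanges the two factors of the spherical harmonics and of the second-order
  Clebsch-Gordan matrices, so under the symmetry hypothesis on the radial functions it intertwines
  the kernels of degrees \<open>(\<omega>, \<iota>)\<close> at \<open>z\<close> with those of the swapped degrees at the swapped point.
  The swap is an isometry of the 6-dimensional space, so neighbourhoods do not change, and
  the attention is unchanged because queries and keys only have their blocks permuted.
\<close>

subsection \<open>Transposition of features\<close>

text \<open>If \<open>k\<close> encodes the position \<open>(m, m')\<close> in a \<open>p \<times> q\<close> matrix, then \<open>transp_idx p q k\<close> encodes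
  \<open>(m', m)\<close> in its \<open>q \<times> p\<close> transpose.\<close>

definition transp_idx :: "nat \<Rightarrow> nat \<Rightarrow> nat \<Rightarrow> nat" where
  "transp_idx p q k = (k mod q) * p + k div q"

text \<open>The bound on \<open>k\<close> gives \<open>k div q < p\<close>, so
  \<open>transp_idx p q k\<close> is a base-\<open>p\<close> expansion with last digit
  \<open>k div q\<close>. This exchange of quotient and remainder later exchanges the two factors of
  the kernels.\<close>

lemma transp_idx_div_mod:
  assumes "k < p * q"
  shows "transp_idx p q k div p = k mod q" and "transp_idx p q k mod p = k div q"
proof -
  have "k div q < p" using assms by (simp add: less_mult_imp_div_less)
  then show "transp_idx p q k div p = k mod q" and "transp_idx p q k mod p = k div q"
    by (simp_all add: transp_idx_def)
qed

lemma mult_add_less: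
  assumes "a < p" and "b < (q::nat)"
  shows "a * q + b < p * q"
proof -
  have "a * q + b < Suc a * q" using assms by simp
  also have "\<dots> \<le> p * q" using assms by (intro mult_le_mono1) simp
  finally show ?thesis .
qed

lemma transp_idx_less:
  assumes "k < p * q"
  shows "transp_idx p q k < p * q"
proof -
  have "k mod q < q" using assms by (cases "q = 0") auto
  moreover have "k div q < p" using assms by (simp add: less_mult_imp_div_less)
  ultimately show ?thesis unfolding transp_idx_def by (metis mult_add_less mult.commute)
qed

lemma transp_idx_transp_idx: "k < p * q \<Longrightarrow> transp_idx q p (transp_idx p q k) = k"
  unfolding transp_idx_def[of q p] by (simp add: transp_idx_div_mod)

text \<open>On these indices \<open>transp_idx q p\<close> inverts \<open>transp_idx p q\<close>, so
  only the order of summation changes. Invariance of inner products and compatibility with matrix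
  products both rest on this.\<close>

lemma sum_transp_idx: "(\<Sum>k<p * q. h (transp_idx p q k)) = (\<Sum>k<p * q. h k)"
proof (rule sum.reindex_bij_witness[where i = "transp_idx q p" and j = "transp_idx p q"])
  fix k
  assume "k \<in> {..<p * q}"
  then have "k < q * p" by (simp add: mult.commute)
  then show "transp_idx p q (transp_idx q p k) = k" and "transp_idx q p k \<in> {..<p * q}"
    using transp_idx_transp_idx[of k q p] transp_idx_less[of k q p] by (simp_all add: mult.commute)
qed (simp_all add: transp_idx_transp_idx transp_idx_less)

text \<open>The parameters \<open>p\<close> and \<open>q\<close> are the dimensions of the result;
  the argument is read as a \<open>q\<close> by \<open>p\<close> matrix.\<close>

definition transp_vec :: "nat \<Rightarrow> nat \<Rightarrow> real vec \<Rightarrow> real vec" where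
  "transp_vec p q v = vec (p * q) (\<lambda>k. v $ transp_idx p q k)"

text \<open>The index is the target degree: features of degree \<open>prod.swap \<iota>\<close> are
  sent to degree \<open>\<iota>\<close>.\<close>

abbreviation feat_swap :: "degree \<Rightarrow> real vec \<Rightarrow> real vec" where
  "feat_swap \<iota> \<equiv> transp_vec (irr_dim (fst \<iota>)) (irr_dim (snd \<iota>))"

lemma transp_vec_carrier [simp]: "transp_vec p q v \<in> carrier_vec (p * q)"
  by (simp add: transp_vec_def)

lemma dim_transp_vec [simp]: "dim_vec (transp_vec p q v) = p * q"
  by (simp add: transp_vec_def)

lemma index_transp_vec: "k < p * q \<Longrightarrow> transp_vec p q v $ k = v $ transp_idx p q k"
  by (simp add: transp_vec_def)

text \<open>Here and below the simplifier must not multiply out the dimensions, which it turns into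
  products of successors.\<close>

lemma mat_to_feat_transpose:
  "mat_to_feat (transpose_mat (feat_to_mat (prod.swap \<iota>) v)) = feat_swap \<iota> v"
proof (rule eq_vecI)
  fix k
  assume "k < dim_vec (feat_swap \<iota> v)"
  then have k: "k < irr_dim (fst \<iota>) * irr_dim (snd \<iota>)" by (simp only: dim_transp_vec)
  then have "k div irr_dim (snd \<iota>) < irr_dim (fst \<iota>)" by (rule less_mult_imp_div_less)
  moreover have "k mod irr_dim (snd \<iota>) < irr_dim (snd \<iota>)" by (rule mod_less_divisor) simp
  ultimately show "mat_to_feat (transpose_mat (feat_to_mat (prod.swap \<iota>) v)) $ k = feat_swap \<iota> v $ k"
    using k by (simp add: mat_to_feat_def feat_to_mat_def transp_vec_def transp_idx_def
        del: mult_Suc mult_Suc_right)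
qed (simp add: mat_to_feat_def feat_to_mat_def)

lemma elu_channel_carrier:
  "\<lbrakk>v \<in> carrier_vec n; w \<in> carrier_vec n\<rbrakk> \<Longrightarrow> elu_channel v w \<in> carrier_vec n"
  by (simp add: elu_channel_def Let_def)

section \<open>Transposition of features as a linear isometry\<close>

context
  fixes p q n :: nat
  assumes n: "n = p * q"
begin

lemma transp_vec_add:
  "\<lbrakk>v \<in> carrier_vec n; w \<in> carrier_vec n\<rbrakk> \<Longrightarrow>
    transp_vec p q (v + w) = transp_vec p q v + transp_vec p q w"
  by (rule eq_vecI) (auto simp: n transp_vec_def transp_idx_less)

lemma transp_vec_minus:
  "\<lbrakk>v \<in> carrier_vec n; w \<in> carrier_vec n\<rbrakk> \<Longrightarrow>
    transp_vec p q (v - w) = transp_vec p q v - transp_vec p q w"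
  by (rule eq_vecI) (auto simp: n transp_vec_def transp_idx_less)

lemma transp_vec_smult:
  "v \<in> carrier_vec n \<Longrightarrow> transp_vec p q (a \<cdot>\<^sub>v v) = a \<cdot>\<^sub>v transp_vec p q v"
  by (rule eq_vecI) (auto simp: n transp_vec_def transp_idx_less)

lemma transp_vec_zero: "transp_vec p q (0\<^sub>v n) = 0\<^sub>v n"
  by (rule eq_vecI) (auto simp: n transp_vec_def transp_idx_less)

lemma transp_vec_finsum:
  assumes "finite A" and "g \<in> A \<rightarrow> carrier_vec n"
  shows "transp_vec p q (finsum_vec TYPE(real) n g A) =
    finsum_vec TYPE(real) n (\<lambda>x. transp_vec p q (g x)) A"
proof -
  have "finsum_vec TYPE(real) n (\<lambda>x. transp_vec p q (g x)) A \<in> carrier_vec n"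
    by (rule finsum_vec_closed) (simp add: n)
  then have "dim_vec (finsum_vec TYPE(real) n (\<lambda>x. transp_vec p q (g x)) A) = n" by simp
  then show ?thesis
    using assms
    by (intro eq_vecI) (auto simp: transp_vec_def index_finsum_vec transp_idx_less n)
qed

lemma transp_vec_scalar_prod:
  "\<lbrakk>v \<in> carrier_vec n; w \<in> carrier_vec n\<rbrakk> \<Longrightarrow> transp_vec p q v \<bullet> transp_vec p q w = v \<bullet> w"
  unfolding scalar_prod_def
  by (simp add: index_transp_vec atLeast0LessThan n
      sum_transp_idx[of "\<lambda>k. v $ k * w $ k"])

text \<open>Reindexing the sum over columns by \<open>transp_idx r s\<close> absorbs the permutation
  of \<open>v\<close>. With this lemma an entrywise comparison of two kernels becomes an
  intertwining relation.\<close>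

lemma transp_vec_mult_mat_vec:
  assumes "A \<in> carrier_mat n (r * s)" and "B \<in> carrier_mat n (r * s)" and "v \<in> carrier_vec (r * s)"
    and AB: "\<And>k l. \<lbrakk>k < n; l < r * s\<rbrakk> \<Longrightarrow> B $$ (k, l) = A $$ (transp_idx p q k, transp_idx r s l)"
  shows "B *\<^sub>v transp_vec r s v = transp_vec p q (A *\<^sub>v v)"
proof (rule eq_vecI)
  fix k
  assume "k < dim_vec (transp_vec p q (A *\<^sub>v v))"
  then have k: "k < n" by (simp add: n)
  have "(B *\<^sub>v transp_vec r s v) $ k =
      (\<Sum>l<r * s. A $$ (transp_idx p q k, transp_idx r s l) * v $ transp_idx r s l)"
    using assms k by (simp add: scalar_prod_def atLeast0LessThan index_transp_vec)
  also have "\<dots> = (\<Sum>l<r * s. A $$ (transp_idx p q k, l) * v $ l)"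
    by (rule sum_transp_idx)
  also have "\<dots> = transp_vec p q (A *\<^sub>v v) $ k"
    using assms(1,3) k transp_idx_less[of k p q]
    by (simp add: scalar_prod_def atLeast0LessThan index_transp_vec n)
  finally show "(B *\<^sub>v transp_vec r s v) $ k = transp_vec p q (A *\<^sub>v v) $ k" .
qed (use assms in \<open>simp add: n\<close>)

text \<open>Weights combine channels, that is rows, whereas transposing every channel permutes
  columns. Each coordinate of the product depends on a single column, so the two operations
  commute.\<close>

lemma vec_mat_mult_transp_rows:
  assumes F: "F \<in> carrier_mat c n" and w: "w \<in> carrier_vec c"
  shows "vec_mat_mult w (mat_of_rows n (map (transp_vec p q) (rows F))) =
    transp_vec p q (vec_mat_mult w F)"
proof (rule eq_vecI)
  fix k
  assume "k < dim_vec (transp_vec p q (vec_mat_mult w F))"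
  then have k: "k < p * q" by simp
  have "col (mat_of_rows n (map (transp_vec p q) (rows F))) k = col F (transp_idx p q k)"
    using F k transp_idx_less[OF k] by (intro eq_vecI) (auto simp: mat_of_rows_index index_transp_vec n)
  then show "vec_mat_mult w (mat_of_rows n (map (transp_vec p q) (rows F))) $ k =
      transp_vec p q (vec_mat_mult w F) $ k"
    using F k transp_idx_less[OF k] by (simp add: vec_mat_mult_def index_transp_vec n)
qed (use F in \<open>simp add: vec_mat_mult_def n\<close>)

text \<open>A row of \<open>W * G\<close> is the corresponding row of \<open>W\<close> applied to
  \<open>G\<close>, which reduces the matrix weights of the Elu layer to the case of a row vector of
  weights.\<close>

lemma row_mult_transp_rows:
  assumes F: "F \<in> carrier_mat c n" and W: "W \<in> carrier_mat d c" and a: "a < d"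
  shows "row (W * mat_of_rows n (map (transp_vec p q) (rows F))) a =
    transp_vec p q (row (W * F) a)"
proof -
  have "row (W * G) a = vec_mat_mult (row W a) G" if "G \<in> carrier_mat c n" for G
    using that W a by (intro eq_vecI) (auto simp: vec_mat_mult_def)
  moreover have "mat_of_rows n (map (transp_vec p q) (rows F)) \<in> carrier_mat c n"
    using F by (intro carrier_matI) simp_all
  ultimately show ?thesis
    using F W a vec_mat_mult_transp_rows[OF F, of "row W a"] by simp
qed

text \<open>The branch is chosen by an inner product, and both branches are built from inner
  products, norms, multiples and differences. Transposition preserves the first two and commutes
  with the others.\<close>

lemma elu_channel_transp_vec:
  assumes "v \<in> carrier_vec n" and "w \<in> carrier_vec n"
  shows "elu_channel (transp_vec p q v) (transp_vec p q w) = transp_vec p q (elu_channel v w)"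
  using assms
  by (simp add: elu_channel_def Let_def vec_norm_def transp_vec_scalar_prod
      flip: transp_vec_smult transp_vec_minus)

end


subsection \<open>Kernels\<close>

lemma sum_kron:
  fixes f g :: "nat \<Rightarrow> real"
  shows "(\<Sum>k<a * b. f (k div b) * g (k mod b)) = (\<Sum>i<a. f i) * (\<Sum>j<b. g j)"
  by (simp add: sum_mult_product sum_product)

text \<open>For a fixed row, the entry of \<open>cg2\<close> in column
  \<open>(m\<^sub>5, m\<^sub>6)\<close> is a factor depending on \<open>m\<^sub>5\<close> times one
  depending on \<open>m\<^sub>6\<close>, just like the Kronecker product, so the sum over columns
  splits. Dividing the row index by \<open>feat_dim \<omega>\<close> gives the input index
  \<open>c\<close> as quotient and the output index \<open>r\<close> as remainder.\<close>

lemma cg2_mult_kron_vec: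
  assumes x: "x \<in> carrier_vec (irr_dim J\<^sub>1)" and y: "y \<in> carrier_vec (irr_dim J\<^sub>2)"
    and r: "r < feat_dim \<omega>" and c: "c < feat_dim \<iota>"
  shows "(cg2 C \<omega> \<iota> J\<^sub>1 J\<^sub>2 *\<^sub>v kron_vec x y) $ (c * feat_dim \<omega> + r) =
    (\<Sum>m<irr_dim J\<^sub>1. cg_coeff C (fst \<iota>) (c div irr_dim (snd \<iota>)) (fst \<omega>) (r div irr_dim (snd \<omega>)) J\<^sub>1 m * x $ m) *
    (\<Sum>m<irr_dim J\<^sub>2. cg_coeff C (snd \<iota>) (c mod irr_dim (snd \<iota>)) (snd \<omega>) (r mod irr_dim (snd \<omega>)) J\<^sub>2 m * y $ m)"
proof -
  \<comment> \<open>These names hide the products of dimensions from arithmetic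
    simplification.\<close>
  define N where "N = feat_dim \<omega>"
  define a b where ab: "a = irr_dim J\<^sub>1" "b = irr_dim J\<^sub>2"
  define h\<^sub>1 where "h\<^sub>1 = cg_coeff C (fst \<iota>) (c div irr_dim (snd \<iota>)) (fst \<omega>) (r div irr_dim (snd \<omega>)) J\<^sub>1"
  define h\<^sub>2 where "h\<^sub>2 = cg_coeff C (snd \<iota>) (c mod irr_dim (snd \<iota>)) (snd \<omega>) (r mod irr_dim (snd \<omega>)) J\<^sub>2"
  have R: "c * N + r < feat_dim \<iota> * N" using c r unfolding N_def by (rule mult_add_less)
  have dm: "r < N" "(c * N + r) div N = c" using r unfolding N_def[symmetric] by simp_all
  have row: "row (cg2 C \<omega> \<iota> J\<^sub>1 J\<^sub>2) (c * N + r) = vec (a * b) (\<lambda>k. h\<^sub>1 (k div b) * h\<^sub>2 (k mod b))"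
    using R unfolding cg2_def Let_def N_def[symmetric] ab[symmetric] h\<^sub>1_def h\<^sub>2_def
    by (intro eq_vecI) (simp_all add: dm del: mult_Suc mult_Suc_right)
  have "dim_row (cg2 C \<omega> \<iota> J\<^sub>1 J\<^sub>2) = feat_dim \<iota> * N"
    unfolding cg2_def Let_def N_def by (rule dim_row_mat)
  then have "(cg2 C \<omega> \<iota> J\<^sub>1 J\<^sub>2 *\<^sub>v kron_vec x y) $ (c * N + r) =
      vec (a * b) (\<lambda>k. h\<^sub>1 (k div b) * h\<^sub>2 (k mod b)) \<bullet> kron_vec x y"
    using R row by simp
  also have "\<dots> = (\<Sum>k<a * b. (h\<^sub>1 (k div b) * x $ (k div b)) * (h\<^sub>2 (k mod b) * y $ (k mod b)))"
    using x y unfolding ab[symmetric] by (simp add: scalar_prod_def kron_vec_def atLeast0LessThan mult_ac)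
  also have "\<dots> = (\<Sum>m<a. h\<^sub>1 m * x $ m) * (\<Sum>m<b. h\<^sub>2 m * y $ m)"
    by (rule sum_kron)
  finally show ?thesis unfolding N_def ab h\<^sub>1_def h\<^sub>2_def .
qed

lemma dim_kernel [simp]:
  "dim_row (kernel Y C \<phi> \<omega> \<iota> z) = feat_dim \<omega>"
  "dim_col (kernel Y C \<phi> \<omega> \<iota> z) = feat_dim \<iota>"
  by (simp_all only: kernel_def unstack_cols_def dim_row_mat dim_col_mat)

lemma kernel_carrier: "kernel Y C \<phi> \<omega> \<iota> z \<in> carrier_mat (feat_dim \<omega>) (feat_dim \<iota>)"
  by (rule carrier_matI) (rule dim_kernel)+

lemma finite_cg_range [simp]: "finite (cg_range i j)"
  by (simp add: cg_range_def)

text \<open>Apart from the zero vector, the convention evaluates \<open>Y\<close> only at unit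
  vectors, where its dimension is prescribed.\<close>

lemma Y_dir_carrier:
  assumes "spherical_harmonics \<rho> Y"
  shows "Y_dir Y J x \<in> carrier_vec (irr_dim J)"
proof -
  have Y: "norm u = 1 \<Longrightarrow> Y K u \<in> carrier_vec (irr_dim K)" for K u
    using assms unfolding spherical_harmonics_def by blast
  show ?thesis
    unfolding Y_dir_def using Y[of "x /\<^sub>R norm x" J] Y[of "axis 1 1" 0]
    by (simp del: carrier_vec_dim_vec)
qed

text \<open>Column stacking places entry \<open>(r, c)\<close> at position
  \<open>c * feat_dim \<omega> + r\<close>, where every summand factors. In this form the first and
  second components of the degrees, of the point and of the indices are separated, ready to be
  exchanged.\<close>

lemma kernel_index:
  assumes Y: "spherical_harmonics \<rho> Y"
    and r: "r < feat_dim \<omega>" and c: "c < feat_dim \<iota>"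
  shows "kernel Y C \<phi> \<omega> \<iota> z $$ (r, c) =
    (\<Sum>(J\<^sub>1, J\<^sub>2)\<in>cg_range (fst \<omega>) (fst \<iota>) \<times> cg_range (snd \<omega>) (snd \<iota>).
      \<phi> J\<^sub>1 J\<^sub>2 (norm (fst z)) (norm (snd z)) *
      ((\<Sum>m<irr_dim J\<^sub>1. cg_coeff C (fst \<iota>) (c div irr_dim (snd \<iota>)) (fst \<omega>) (r div irr_dim (snd \<omega>)) J\<^sub>1 m * Y_dir Y J\<^sub>1 (fst z) $ m) *
       (\<Sum>m<irr_dim J\<^sub>2. cg_coeff C (snd \<iota>) (c mod irr_dim (snd \<iota>)) (snd \<omega>) (r mod irr_dim (snd \<omega>)) J\<^sub>2 m * Y_dir Y J\<^sub>2 (snd z) $ m)))"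
proof -
  let ?t = "\<lambda>(J\<^sub>1, J\<^sub>2). \<phi> J\<^sub>1 J\<^sub>2 (norm (fst z)) (norm (snd z)) \<cdot>\<^sub>v
    (cg2 C \<omega> \<iota> J\<^sub>1 J\<^sub>2 *\<^sub>v kron_vec (Y_dir Y J\<^sub>1 (fst z)) (Y_dir Y J\<^sub>2 (snd z)))"
  let ?A = "cg_range (fst \<omega>) (fst \<iota>) \<times> cg_range (snd \<omega>) (snd \<iota>)"
  let ?R = "c * feat_dim \<omega> + r"
  have dim: "dim_row (cg2 C \<omega> \<iota> J\<^sub>1 J\<^sub>2) = feat_dim \<omega> * feat_dim \<iota>" for J\<^sub>1 J\<^sub>2
    unfolding cg2_def Let_def dim_row_mat by (rule mult.commute)
  have R: "?R < feat_dim \<omega> * feat_dim \<iota>"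
    using mult_add_less[OF c r] by (subst mult.commute)
  have t: "?t \<in> ?A \<rightarrow> carrier_vec (feat_dim \<omega> * feat_dim \<iota>)"
    by (auto simp only: Pi_iff carrier_vec_def mem_Collect_eq
        index_smult_vec dim_mult_mat_vec dim split: prod.split)
  have "kernel Y C \<phi> \<omega> \<iota> z $$ (r, c) = kernel_vec Y C \<phi> \<omega> \<iota> z $ ?R"
    using r c by (simp only: kernel_def unstack_cols_def index_mat prod.case)
  also have "\<dots> = (\<Sum>J\<in>?A. ?t J $ ?R)"
    unfolding kernel_vec_def using R t by (intro index_finsum_vec) simp_all
  also have "\<dots> = (\<Sum>(J\<^sub>1, J\<^sub>2)\<in>?A. \<phi> J\<^sub>1 J\<^sub>2 (norm (fst z)) (norm (snd z)) *
      (cg2 C \<omega> \<iota> J\<^sub>1 J\<^sub>2 *\<^sub>v kron_vec (Y_dir Y J\<^sub>1 (fst z)) (Y_dir Y J\<^sub>2 (snd z))) $ ?R)"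
    using R by (intro sum.cong refl) (simp only: split_beta index_smult_vec dim_mult_mat_vec dim)
  finally show ?thesis
    by (simp only: cg2_mult_kron_vec[OF Y_dir_carrier[OF Y] Y_dir_carrier[OF Y] r c])
qed

text \<open>Transposed row and column indices have quotient and remainder exchanged, so the two
  factors of each summand trade places. Here \<open>\<psi>\<close> holds the radial functions of the
  swapped degrees.\<close>

lemma kernel_swap:
  assumes Y: "spherical_harmonics \<rho> Y" and v: "v \<in> carrier_vec (feat_dim \<iota>)"
    and \<phi>: "\<And>J\<^sub>1 J\<^sub>2. \<lbrakk>J\<^sub>1 \<in> cg_range (fst \<omega>) (fst \<iota>); J\<^sub>2 \<in> cg_range (snd \<omega>) (snd \<iota>)\<rbrakk> \<Longrightarrow>
      \<phi> J\<^sub>1 J\<^sub>2 (norm (fst z)) (norm (snd z)) = \<psi> J\<^sub>2 J\<^sub>1 (norm (snd z)) (norm (fst z))"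
  shows "kernel Y C \<phi> \<omega> \<iota> z *\<^sub>v feat_swap \<iota> v =
    feat_swap \<omega> (kernel Y C \<psi> (prod.swap \<omega>) (prod.swap \<iota>) (prod.swap z) *\<^sub>v v)"
proof (rule transp_vec_mult_mat_vec[OF refl _ kernel_carrier v])
  show "kernel Y C \<psi> (prod.swap \<omega>) (prod.swap \<iota>) (prod.swap z) \<in> carrier_mat (feat_dim \<omega>) (feat_dim \<iota>)"
    using kernel_carrier[of Y C \<psi> "prod.swap \<omega>" "prod.swap \<iota>" "prod.swap z"]
    by (simp only: fst_swap snd_swap mult.commute)
  fix k l
  assume k: "k < feat_dim \<omega>" and l: "l < feat_dim \<iota>"
  let ?k = "transp_idx (irr_dim (fst \<omega>)) (irr_dim (snd \<omega>)) k"
  let ?l = "transp_idx (irr_dim (fst \<iota>)) (irr_dim (snd \<iota>)) l"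
  have k': "?k < feat_dim (prod.swap \<omega>)" and l': "?l < feat_dim (prod.swap \<iota>)"
    using transp_idx_less[OF k] transp_idx_less[OF l] by (simp_all only: fst_swap snd_swap mult.commute)
  show "kernel Y C \<phi> \<omega> \<iota> z $$ (k, l) =
      kernel Y C \<psi> (prod.swap \<omega>) (prod.swap \<iota>) (prod.swap z) $$ (?k, ?l)"
    unfolding kernel_index[OF Y k l] kernel_index[OF Y k' l'] fst_swap snd_swap
      transp_idx_div_mod[OF k] transp_idx_div_mod[OF l]
    \<comment> \<open>The summand at \<open>(J\<^sub>1, J\<^sub>2)\<close> matches the one at
      \<open>(J\<^sub>2, J\<^sub>1)\<close> for the swapped degrees, up to commuting the two
      factors.\<close>
    by (rule sum.reindex_bij_witness[where i = prod.swap and j = prod.swap])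
      (auto simp: \<phi> mult.commute)
qed


subsection \<open>Layers\<close>

lemma swap_field_eq:
  "swap_field f = map (\<lambda>(z, F). (prod.swap z,
     \<lambda>\<iota>. mat_of_rows (feat_dim \<iota>) (map (feat_swap \<iota>) (rows (F (prod.swap \<iota>)))))) f"
  unfolding swap_field_def by (simp only: mat_to_feat_transpose)

lemma length_swap_field [simp]: "length (swap_field f) = length f"
  by (simp add: swap_field_def)

lemma pt_swap_field: "u < length f \<Longrightarrow> pt (swap_field f) u = prod.swap (pt f u)"
  by (simp add: pt_def swap_field_def case_prod_unfold)

lemma feats_swap_field:
  "u < length f \<Longrightarrow> feats (swap_field f) u \<iota> =
    mat_of_rows (feat_dim \<iota>) (map (feat_swap \<iota>) (rows (feats f u (prod.swap \<iota>))))"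
  unfolding feats_def swap_field_eq by (simp add: case_prod_unfold)

lemma feats_carrier:
  "\<lbrakk>f \<in> tensor_fields c; u < length f\<rbrakk> \<Longrightarrow> feats f u \<iota> \<in> carrier_mat (c \<iota>) (feat_dim \<iota>)"
  by (simp only: tensor_fields_def feats_def case_prod_unfold mem_Collect_eq) (metis nth_mem)

lemma row_feats_swap_field:
  assumes "f \<in> tensor_fields c" and "u < length f" and "b < c (prod.swap \<iota>)"
  shows "row (feats (swap_field f) u \<iota>) b = feat_swap \<iota> (row (feats f u (prod.swap \<iota>)) b)"
proof -
  have b: "b < dim_row (feats f u (prod.swap \<iota>))"
    using feats_carrier[OF assms(1,2), of "prod.swap \<iota>"] assms(3) by simp
  show ?thesis
    unfolding feats_swap_field[OF assms(2)] using b
    by (subst mat_of_rows_row) (simp_all del: mult_Suc mult_Suc_right add: nth_rows)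
qed

section \<open>Nearest neighbours under the swap\<close>

lemma knn_less: "v \<in> knn k f u \<Longrightarrow> v < length f"
  unfolding knn_def using set_take_subset by fastforce

lemma finite_knn [simp]: "finite (knn k f u)"
  by (simp add: knn_def)

lemma dist_swap: "dist (prod.swap x) (prod.swap y) = dist x y"
  by (simp add: dist_prod_def prod.swap_def add.commute)

lemma insort_key_cong:
  "(\<And>y. y \<in> insert x (set xs) \<Longrightarrow> g y = h y) \<Longrightarrow> insort_key g x xs = insort_key h x xs"
  by (induction xs) auto

text \<open>Agreement is asked only on the list, because points of the swapped field are known only
  for indices below its length.\<close>

lemma sort_key_cong:
  "(\<And>x. x \<in> set xs \<Longrightarrow> g x = h x) \<Longrightarrow> sort_key g xs = sort_key h xs"
  by (induction xs) (auto intro: insort_key_cong)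

text \<open>Exchanging the two factors preserves distances and leaves the indices of points alone.
  The stable sort therefore sees the same keys on the same list, and ties are broken in the same
  way.\<close>

lemma knn_swap_field:
  assumes "u < length f"
  shows "knn k (swap_field f) u = knn k f u"
proof -
  have "sort_key (\<lambda>v. dist (pt (swap_field f) u) (pt (swap_field f) v)) [0..<length f] =
      sort_key (\<lambda>v. dist (pt f u) (pt f v)) [0..<length f]"
    using assms by (intro sort_key_cong) (simp add: pt_swap_field dist_swap)
  then show ?thesis by (simp add: knn_def)
qed

text \<open>This turns the exponent of the attention into a sum over degrees, in which the order of
  the blocks no longer matters.\<close>

lemma scalar_prod_concat_vecs:
  assumes "\<And>x. x \<in> set xs \<Longrightarrow> dim_vec (g x) = dim_vec (h x)"
  shows "concat_vecs (map g xs) \<bullet> concat_vecs (map h xs) = (\<Sum>x\<leftarrow>xs. g x \<bullet> h x)"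
proof -
  \<comment> \<open>Equality of the total lengths is carried through the induction, since splitting
    a product of appended vectors requires matching blocks.\<close>
  have "dim_vec (concat_vecs (map g xs)) = dim_vec (concat_vecs (map h xs)) \<and> ?thesis"
    using assms
  proof (induction xs)
    case Nil
    then show ?case by (simp add: concat_vecs_def)
  next
    case (Cons x xs)
    then have dim: "dim_vec (concat_vecs (map g xs)) = dim_vec (concat_vecs (map h xs))"
      "dim_vec (g x) = dim_vec (h x)" by simp_all
    have "(g x @\<^sub>v concat_vecs (map g xs)) \<bullet> (h x @\<^sub>v concat_vecs (map h xs)) =
        g x \<bullet> h x + concat_vecs (map g xs) \<bullet> concat_vecs (map h xs)"
      using dim by (intro scalar_prod_append[OF carrier_vec_dim_vec carrier_vec_dim_vec]) (auto intro: carrier_vecI)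
    with Cons dim show ?case by (simp add: concat_vecs_def)
  qed
  then show ?thesis ..
qed

section \<open>Sums over input degrees and channels\<close>

lemma set_in_deg_list: "finite (degs (in_ch T)) \<Longrightarrow> set (in_deg_list T) = degs (in_ch T)"
  by (simp add: in_deg_list_def image_image)

lemma sum_list_in_deg_list:
  assumes "finite (degs (in_ch T))"
  shows "sum_list (map g (in_deg_list T)) = sum g (degs (in_ch T))"
proof -
  have "distinct (in_deg_list T)"
    \<comment> \<open>The list decodes distinct codes and \<open>prod_decode\<close> is
      injective.\<close>
    by (simp add: in_deg_list_def distinct_map) (metis inj_on_subset inj_prod_decode subset_UNIV)
  then show ?thesis using set_in_deg_list[OF assms] by (metis sum_list_distinct_conv_sum_set)
qed

lemma degs_swap: "channel_type c \<Longrightarrow> prod.swap \<iota> \<in> degs c \<longleftrightarrow> \<iota> \<in> degs c"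
  by (cases \<iota>) (simp add: degs_def channel_type_def)

lemma channel_type_swap: "channel_type c \<Longrightarrow> c (prod.swap \<iota>) = c \<iota>"
  by (cases \<iota>) (simp add: channel_type_def)

lemma finite_degs: "channel_type c \<Longrightarrow> finite (degs c)"
  by (simp add: channel_type_def)

lemma feat_dim_swap: "feat_dim (prod.swap \<iota>) = feat_dim \<iota>"
  by (simp only: fst_swap snd_swap mult.commute)

lemma in_feat_sum_carrier:
  assumes "\<And>\<iota> b. dim_row (K \<iota> b) = feat_dim \<omega>"
  shows "in_feat_sum T \<omega> K f v \<in> carrier_vec (feat_dim \<omega>)"
  unfolding in_feat_sum_def using assms
  by (intro finsum_vec_closed) (auto intro!: carrier_vecI simp del: mult_Suc mult_Suc_right)

lemma in_feat_sum_index: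
  assumes "channel_type (in_ch T)" and "\<And>\<iota> b. dim_row (K \<iota> b) = feat_dim \<omega>" and "k < feat_dim \<omega>"
  shows "in_feat_sum T \<omega> K f v $ k =
    (\<Sum>(\<iota>, b)\<in>(SIGMA \<iota>:degs (in_ch T). {..<in_ch T \<iota>}). (K \<iota> b *\<^sub>v row (feats f v \<iota>) b) $ k)"
  unfolding in_feat_sum_def
  by (subst index_finsum_vec)
    (use assms in \<open>auto intro!: carrier_vecI sum.cong finite_SigmaI finite_degs
      simp del: mult_Suc mult_Suc_right\<close>)

text \<open>The features read in degree \<open>\<iota>\<close> of the swapped field are transposes
  of those in degree \<open>prod.swap \<iota>\<close>, and \<open>KL\<close> moves the transposition
  across the kernel. What remains is a reindexing of the sum, done coordinate by coordinate.\<close>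

lemma in_feat_sum_swap_field:
  assumes T: "channel_type (in_ch T)" and f: "f \<in> tensor_fields (in_ch T)" and v: "v < length f"
    and K: "\<And>\<iota> b. dim_row (K \<iota> b) = feat_dim \<omega>" and L: "\<And>\<iota> b. dim_row (L \<iota> b) = feat_dim \<omega>"
    and KL: "\<And>\<iota> b x. \<lbrakk>\<iota> \<in> degs (in_ch T); b < in_ch T \<iota>; x \<in> carrier_vec (feat_dim \<iota>)\<rbrakk> \<Longrightarrow>
      K \<iota> b *\<^sub>v feat_swap \<iota> x = feat_swap \<omega> (L (prod.swap \<iota>) b *\<^sub>v x)"
  shows "in_feat_sum T \<omega> K (swap_field f) v = feat_swap \<omega> (in_feat_sum T (prod.swap \<omega>) L f v)"
proof (rule eq_vecI)
  show "dim_vec (in_feat_sum T \<omega> K (swap_field f) v) =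
      dim_vec (feat_swap \<omega> (in_feat_sum T (prod.swap \<omega>) L f v))"
    using in_feat_sum_carrier[OF K] by (simp only: carrier_vec_def mem_Collect_eq dim_transp_vec)
  fix k
  assume "k < dim_vec (feat_swap \<omega> (in_feat_sum T (prod.swap \<omega>) L f v))"
  then have k: "k < feat_dim \<omega>" by (simp only: dim_transp_vec)
  let ?k = "transp_idx (irr_dim (fst \<omega>)) (irr_dim (snd \<omega>)) k"
  have k': "?k < feat_dim (prod.swap \<omega>)" using transp_idx_less[OF k] by (simp only: feat_dim_swap)
  have "in_feat_sum T \<omega> K (swap_field f) v $ k =
      (\<Sum>(\<iota>, b)\<in>(SIGMA \<iota>:degs (in_ch T). {..<in_ch T \<iota>}). (K \<iota> b *\<^sub>v row (feats (swap_field f) v \<iota>) b) $ k)"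
    by (rule in_feat_sum_index[OF T K k])
  also have "\<dots> = (\<Sum>(\<iota>, b)\<in>(SIGMA \<iota>:degs (in_ch T). {..<in_ch T \<iota>}). (L \<iota> b *\<^sub>v row (feats f v \<iota>) b) $ ?k)"
  \<comment> \<open>The degree is swapped and the channel kept; degrees \<open>\<iota>\<close> and
    \<open>prod.swap \<iota>\<close> have equally many channels, so this is an involution of the
    index set.\<close>
  proof (rule sum.reindex_bij_witness[where i = "map_prod prod.swap id" and j = "map_prod prod.swap id"])
    fix x
    assume x: "x \<in> (SIGMA \<iota>:degs (in_ch T). {..<in_ch T \<iota>})"
    then obtain \<iota> b where [simp]: "x = (\<iota>, b)" and \<iota>: "\<iota> \<in> degs (in_ch T)" and b: "b < in_ch T \<iota>" by auto
    have b': "b < in_ch T (prod.swap \<iota>)" using b T by (simp add: channel_type_swap)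
    have "row (feats f v (prod.swap \<iota>)) b \<in> carrier_vec (feat_dim \<iota>)"
      using row_carrier_vec[OF b' feats_carrier[OF f v]] unfolding feat_dim_swap .
    then have "(K \<iota> b *\<^sub>v row (feats (swap_field f) v \<iota>) b) $ k =
        (L (prod.swap \<iota>) b *\<^sub>v row (feats f v (prod.swap \<iota>)) b) $ ?k"
      using KL[OF \<iota> b] by (simp only: row_feats_swap_field[OF f v b'] index_transp_vec[OF k])
    then show "(case map_prod prod.swap id x of (\<iota>, b) \<Rightarrow> (L \<iota> b *\<^sub>v row (feats f v \<iota>) b) $ ?k) =
        (case x of (\<iota>, b) \<Rightarrow> (K \<iota> b *\<^sub>v row (feats (swap_field f) v \<iota>) b) $ k)"
      by simp
  qed (use T in \<open>auto simp: degs_def channel_type_def\<close>)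
  also have "\<dots> = in_feat_sum T (prod.swap \<omega>) L f v $ ?k"
    using L by (intro in_feat_sum_index[symmetric, OF T _ k']) (simp only: feat_dim_swap)
  finally show "in_feat_sum T \<omega> K (swap_field f) v $ k =
      feat_swap \<omega> (in_feat_sum T (prod.swap \<omega>) L f v) $ k"
    by (simp only: index_transp_vec[OF k])
qed

lemma finsum_vec_cong:
  assumes "finite A" and "g \<in> A \<rightarrow> carrier_vec n" and "\<And>x. x \<in> A \<Longrightarrow> g x = h x"
  shows "finsum_vec TYPE(real) n g A = finsum_vec TYPE(real) n h A"
proof (rule eq_vecI)
  have h: "h \<in> A \<rightarrow> carrier_vec n" using assms(2,3) by (metis Pi_cong)
  have "finsum_vec TYPE(real) n h A \<in> carrier_vec n" "finsum_vec TYPE(real) n g A \<in> carrier_vec n"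
    using assms(2) h by (simp_all add: finsum_vec_closed)
  then have dim: "dim_vec (finsum_vec TYPE(real) n h A) = n" "dim_vec (finsum_vec TYPE(real) n g A) = n"
    by simp_all
  then show "dim_vec (finsum_vec TYPE(real) n g A) = dim_vec (finsum_vec TYPE(real) n h A)" by simp
  show "finsum_vec TYPE(real) n g A $ i = finsum_vec TYPE(real) n h A $ i"
    if "i < dim_vec (finsum_vec TYPE(real) n h A)" for i
    using that h assms by (simp add: dim index_finsum_vec)
qed

lemma vec_mat_mult_carrier: "F \<in> carrier_mat c n \<Longrightarrow> vec_mat_mult w F \<in> carrier_vec n"
  by (simp add: vec_mat_mult_def)

lemma vec_mat_mult_feats_swap_field:
  assumes "channel_type c" and f: "f \<in> tensor_fields c" and u: "u < length f" and w: "w \<in> carrier_vec (c \<iota>)"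
  shows "vec_mat_mult w (feats (swap_field f) u \<iota>) =
    feat_swap \<iota> (vec_mat_mult w (feats f u (prod.swap \<iota>)))"
  unfolding feats_swap_field[OF u]
  using feats_carrier[OF f u, of "prod.swap \<iota>"] w
  unfolding feat_dim_swap channel_type_swap[OF assms(1)]
  by (rule vec_mat_mult_transp_rows[OF refl])

section \<open>Equivariance of the transformer layer\<close>

locale swap_symmetric_transformer =
  fixes \<rho> :: "nat \<Rightarrow> real^3^3 \<Rightarrow> real mat" and Y :: "nat \<Rightarrow> real^3 \<Rightarrow> real vec"
    and C :: "nat \<Rightarrow> nat \<Rightarrow> nat \<Rightarrow> real mat" and T :: transformer and f :: tensor_field
  assumes Y: "spherical_harmonics \<rho> Y" and T: "transformer_layer T"
    and self_wt: "\<And>\<omega>. \<omega> \<in> degs (in_ch T) \<inter> degs (out_ch T) \<Longrightarrow> self_wt T \<omega> = self_wt T (prod.swap \<omega>)"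
    and query_wt: "\<And>\<omega>. \<omega> \<in> degs (in_ch T) \<Longrightarrow> query_wt T \<omega> = query_wt T (prod.swap \<omega>)"
    and key_rad: "\<And>\<omega> \<iota> b J\<^sub>1 J\<^sub>2 (z\<^sub>1::real^3) (z\<^sub>2::real^3).
      \<lbrakk>\<omega> \<in> degs (in_ch T); \<iota> \<in> degs (in_ch T); b < in_ch T \<iota>;
        J\<^sub>1 \<in> cg_range (fst \<omega>) (fst \<iota>); J\<^sub>2 \<in> cg_range (snd \<omega>) (snd \<iota>)\<rbrakk> \<Longrightarrow>
      key_rad T \<omega> \<iota> b J\<^sub>1 J\<^sub>2 (norm z\<^sub>1) (norm z\<^sub>2) =
      key_rad T (prod.swap \<omega>) (prod.swap \<iota>) b J\<^sub>2 J\<^sub>1 (norm z\<^sub>2) (norm z\<^sub>1)"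
    and val_rad: "\<And>\<omega> \<iota> a b J\<^sub>1 J\<^sub>2 (z\<^sub>1::real^3) (z\<^sub>2::real^3).
      \<lbrakk>\<omega> \<in> degs (out_ch T); \<iota> \<in> degs (in_ch T); a < out_ch T \<omega>; b < in_ch T \<iota>;
        J\<^sub>1 \<in> cg_range (fst \<omega>) (fst \<iota>); J\<^sub>2 \<in> cg_range (snd \<omega>) (snd \<iota>)\<rbrakk> \<Longrightarrow>
      val_rad T \<omega> \<iota> a b J\<^sub>1 J\<^sub>2 (norm z\<^sub>1) (norm z\<^sub>2) =
      val_rad T (prod.swap \<omega>) (prod.swap \<iota>) a b J\<^sub>2 J\<^sub>1 (norm z\<^sub>2) (norm z\<^sub>1)"
    and f: "f \<in> tensor_fields (in_ch T)"
begin

lemma in_ch: "channel_type (in_ch T)" and out_ch: "channel_type (out_ch T)"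
  using T by (simp_all add: transformer_layer_def)

text \<open>Swapping is additive, so relative positions are swapped along with the points and
  \<open>kernel_swap\<close> applies to every kernel. Leaving \<open>\<phi>\<close> and
  \<open>\<psi>\<close> general lets the same argument serve keys and values.\<close>

lemma in_feat_sum_kernel_swap:
  assumes "u < length f" and v: "v < length f"
    and \<phi>: "\<And>\<iota> b J\<^sub>1 J\<^sub>2 (z\<^sub>1::real^3) (z\<^sub>2::real^3).
      \<lbrakk>\<iota> \<in> degs (in_ch T); b < in_ch T \<iota>;
        J\<^sub>1 \<in> cg_range (fst \<omega>) (fst \<iota>); J\<^sub>2 \<in> cg_range (snd \<omega>) (snd \<iota>)\<rbrakk> \<Longrightarrow>
      \<phi> \<iota> b J\<^sub>1 J\<^sub>2 (norm z\<^sub>1) (norm z\<^sub>2) = \<psi> (prod.swap \<iota>) b J\<^sub>2 J\<^sub>1 (norm z\<^sub>2) (norm z\<^sub>1)"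
  shows "in_feat_sum T \<omega> (\<lambda>\<iota> b. kernel Y C (\<phi> \<iota> b) \<omega> \<iota> (pt (swap_field f) v - pt (swap_field f) u)) (swap_field f) v =
    feat_swap \<omega> (in_feat_sum T (prod.swap \<omega>)
      (\<lambda>\<iota> b. kernel Y C (\<psi> \<iota> b) (prod.swap \<omega>) \<iota> (pt f v - pt f u)) f v)"
proof (rule in_feat_sum_swap_field[OF in_ch f v])
  fix \<iota> b and x :: "real vec"
  assume \<iota>: "\<iota> \<in> degs (in_ch T)" and b: "b < in_ch T \<iota>" and x: "x \<in> carrier_vec (feat_dim \<iota>)"
  let ?z = "pt (swap_field f) v - pt (swap_field f) u"
  have z: "prod.swap ?z = pt f v - pt f u"
    using assms(1,2) by (simp add: pt_swap_field prod_eq_iff)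
  show "kernel Y C (\<phi> \<iota> b) \<omega> \<iota> ?z *\<^sub>v feat_swap \<iota> x =
      feat_swap \<omega> (kernel Y C (\<psi> (prod.swap \<iota>) b) (prod.swap \<omega>) (prod.swap \<iota>) (pt f v - pt f u) *\<^sub>v x)"
    unfolding z[symmetric] by (rule kernel_swap[OF Y x]) (rule \<phi>[OF \<iota> b])
qed (simp_all only: dim_kernel feat_dim_swap)

text \<open>The blocks of query and key in degree \<open>\<omega>\<close> become transposes of the
  original blocks in degree \<open>prod.swap \<omega>\<close>. Their inner product is preserved, and
  the sum runs over a degree set closed under swapping.\<close>

lemma query_key_swap:
  assumes u: "u < length f" and v: "v < length f"
  shows "query T (swap_field f) u \<bullet> key Y C T (swap_field f) u v = query T f u \<bullet> key Y C T f u v"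
proof -
  define q where "q g \<omega> = vec_mat_mult (query_wt T \<omega>) (feats g u \<omega>)" for g \<omega>
  define k where "k g \<omega> = in_feat_sum T \<omega>
    (\<lambda>\<iota> b. kernel Y C (key_rad T \<omega> \<iota> b) \<omega> \<iota> (pt g v - pt g u)) g v" for g \<omega>
  have q: "q f \<omega> \<in> carrier_vec (feat_dim \<omega>)" for \<omega>
    unfolding q_def by (rule vec_mat_mult_carrier[OF feats_carrier[OF f u]])
  have k: "k g \<omega> \<in> carrier_vec (feat_dim \<omega>)" for g \<omega>
    unfolding k_def by (rule in_feat_sum_carrier) (rule dim_kernel)
  have q': "q (swap_field f) \<omega> = feat_swap \<omega> (q f (prod.swap \<omega>))" if "\<omega> \<in> degs (in_ch T)" for \<omega>
  proof -
    have "query_wt T \<omega> \<in> carrier_vec (in_ch T \<omega>)"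
      using T that by (simp add: transformer_layer_def)
    from vec_mat_mult_feats_swap_field[OF in_ch f u this] show ?thesis
      unfolding q_def query_wt[OF that] .
  qed
  have k': "k (swap_field f) \<omega> = feat_swap \<omega> (k f (prod.swap \<omega>))" if "\<omega> \<in> degs (in_ch T)" for \<omega>
    unfolding k_def by (rule in_feat_sum_kernel_swap[OF u v]) (rule key_rad[OF that])
  \<comment> \<open>This is applied to both the swapped and the original field; the premise on
    dimensions makes the blocks of the two concatenations match.\<close>
  have qk: "query T g u \<bullet> key Y C T g u v = (\<Sum>\<omega>\<in>degs (in_ch T). q g \<omega> \<bullet> k g \<omega>)"
    if "\<And>\<omega>. \<omega> \<in> degs (in_ch T) \<Longrightarrow> dim_vec (q g \<omega>) = feat_dim \<omega>" for g
  proof -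
    have "set (in_deg_list T) = degs (in_ch T)"
      using finite_degs[OF in_ch] by (rule set_in_deg_list)
    then have "dim_vec (q g \<omega>) = dim_vec (k g \<omega>)" if "\<omega> \<in> set (in_deg_list T)" for \<omega>
      using \<open>\<And>\<omega>. \<omega> \<in> degs (in_ch T) \<Longrightarrow> dim_vec (q g \<omega>) = feat_dim \<omega>\<close> that k[of g \<omega>]
      by (simp only: carrier_vec_def mem_Collect_eq)
    from scalar_prod_concat_vecs[OF this, of "in_deg_list T" "\<lambda>\<omega>. \<omega>"] show ?thesis
      unfolding query_def key_def q_def[symmetric] k_def[symmetric]
      by (simp add: sum_list_in_deg_list finite_degs[OF in_ch])
  qed
  have "query T (swap_field f) u \<bullet> key Y C T (swap_field f) u v =
      (\<Sum>\<omega>\<in>degs (in_ch T). q (swap_field f) \<omega> \<bullet> k (swap_field f) \<omega>)"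
    by (rule qk) (simp only: q' dim_transp_vec)
  also have "\<dots> = (\<Sum>\<omega>\<in>degs (in_ch T). q f (prod.swap \<omega>) \<bullet> k f (prod.swap \<omega>))"
  proof (rule sum.cong[OF refl])
    fix \<omega>
    assume "\<omega> \<in> degs (in_ch T)"
    then show "q (swap_field f) \<omega> \<bullet> k (swap_field f) \<omega> = q f (prod.swap \<omega>) \<bullet> k f (prod.swap \<omega>)"
      using transp_vec_scalar_prod[OF refl q[of "prod.swap \<omega>", unfolded feat_dim_swap]
        k[of f "prod.swap \<omega>", unfolded feat_dim_swap]]
      by (simp only: q' k')
  qed
  also have "\<dots> = (\<Sum>\<omega>\<in>degs (in_ch T). q f \<omega> \<bullet> k f \<omega>)"
    \<comment> \<open>Closure of the input degrees under \<open>prod.swap\<close> makes the swap a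
      permutation of the summands.\<close>
    by (rule sum.reindex_bij_witness[where i = prod.swap and j = prod.swap])
      (simp_all only: degs_swap[OF in_ch] swap_swap)
  also have "\<dots> = query T f u \<bullet> key Y C T f u v"
    by (rule qk[symmetric]) (use q in \<open>simp only: carrier_vec_def mem_Collect_eq\<close>)
  finally show ?thesis .
qed

lemma attention_swap:
  assumes "u < length f" and "v < length f"
  shows "attention Y C T (swap_field f) u v = attention Y C T f u v"
proof -
  have "(\<Sum>v'\<in>knn (num_nbrs T) f u - {u}. exp (query T (swap_field f) u \<bullet> key Y C T (swap_field f) u v')) =
      (\<Sum>v'\<in>knn (num_nbrs T) f u - {u}. exp (query T f u \<bullet> key Y C T f u v'))"
    by (rule sum.cong[OF refl]) (use assms in \<open>auto simp: query_key_swap dest: knn_less\<close>)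
  then show ?thesis
    unfolding attention_def knn_swap_field[OF assms(1)] by (simp only: query_key_swap[OF assms])
qed

lemma attention_term_carrier:
  "attention Y C T f u v \<cdot>\<^sub>v in_feat_sum T \<omega> (\<lambda>\<iota> b. kernel Y C (\<phi> \<iota> b) \<omega> \<iota> z) f v \<in> carrier_vec (feat_dim \<omega>)"
  by (rule smult_carrier_vec[THEN iffD2], rule in_feat_sum_carrier) (rule dim_kernel)

lemma out_feat_carrier:
  assumes "u < length f"
  shows "out_feat Y C T f u \<omega> a \<in> carrier_vec (feat_dim \<omega>)"
  unfolding out_feat_def
  by (intro add_carrier_vec finsum_vec_closed Pi_I attention_term_carrier)
    (simp only: vec_mat_mult_carrier[OF feats_carrier[OF f assms]] zero_carrier_vec split: if_split, simp)

text \<open>The self-interaction term and the sum over neighbours are transported separately;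
  additivity of transposition joins them.\<close>

lemma out_feat_swap:
  assumes u: "u < length f" and \<omega>: "\<omega> \<in> degs (out_ch T)" and a: "a < out_ch T \<omega>"
  shows "out_feat Y C T (swap_field f) u \<omega> a = feat_swap \<omega> (out_feat Y C T f u (prod.swap \<omega>) a)"
proof -
  let ?N = "knn (num_nbrs T) f u - {u}"
  let ?S = "\<lambda>g \<omega>. if \<omega> \<in> degs (in_ch T) then vec_mat_mult (row (self_wt T \<omega>) a) (feats g u \<omega>)
      else 0\<^sub>v (feat_dim \<omega>)"
  let ?t = "\<lambda>g \<omega> v. attention Y C T g u v \<cdot>\<^sub>v
    in_feat_sum T \<omega> (\<lambda>\<iota> b. kernel Y C (val_rad T \<omega> \<iota> a b) \<omega> \<iota> (pt g v - pt g u)) g v"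
  \<comment> \<open>Either both \<open>\<omega>\<close> and \<open>prod.swap \<omega>\<close> are
    input degrees, and their weights agree, or neither is, and both terms are zero.\<close>
  have S: "?S (swap_field f) \<omega> = feat_swap \<omega> (?S f (prod.swap \<omega>))"
  proof (cases "\<omega> \<in> degs (in_ch T)")
    case True
    then have "self_wt T \<omega> \<in> carrier_mat (out_ch T \<omega>) (in_ch T \<omega>)"
      using T \<omega> by (simp add: transformer_layer_def)
    then have "row (self_wt T \<omega>) a \<in> carrier_vec (in_ch T \<omega>)"
      by (rule row_carrier_vec[OF a])
    from vec_mat_mult_feats_swap_field[OF in_ch f u this] show ?thesis
      using True self_wt[of \<omega>] \<omega> by (simp only: degs_swap[OF in_ch] if_True Int_iff simp_thms)
  next
    case False
    then show ?thesis
      by (simp only: degs_swap[OF in_ch] if_False feat_dim_swap transp_vec_zero[OF refl])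
  qed
  have t_carrier: "?t f (prod.swap \<omega>) v \<in> carrier_vec (feat_dim \<omega>)" for v
    using attention_term_carrier[of u v "prod.swap \<omega>"] unfolding feat_dim_swap .
  have t: "?t (swap_field f) \<omega> v = feat_swap \<omega> (?t f (prod.swap \<omega>) v)" if "v \<in> ?N" for v
  proof -
    have v: "v < length f" using that by (auto dest: knn_less)
    have "in_feat_sum T (prod.swap \<omega>) (\<lambda>\<iota> b. kernel Y C (val_rad T (prod.swap \<omega>) \<iota> a b) (prod.swap \<omega>) \<iota> (pt f v - pt f u)) f v
        \<in> carrier_vec (feat_dim (prod.swap \<omega>))"
      by (rule in_feat_sum_carrier) (rule dim_kernel)
    note c = this[unfolded feat_dim_swap]
    show ?thesis
      \<comment> \<open>The attention coefficients agree, so only the vectors they multiply remain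
        to be compared.\<close>
      unfolding attention_swap[OF u v] transp_vec_smult[OF refl c]
      by (rule arg_cong[where f = "\<lambda>x. _ \<cdot>\<^sub>v x"], rule in_feat_sum_kernel_swap[OF u v])
        (rule val_rad[OF \<omega> _ a])
  qed
  have "finsum_vec TYPE(real) (feat_dim \<omega>) (?t (swap_field f) \<omega>) ?N =
      finsum_vec TYPE(real) (feat_dim \<omega>) (\<lambda>v. feat_swap \<omega> (?t f (prod.swap \<omega>) v)) ?N"
    \<comment> \<open>By \<open>t\<close> the summands on the left are themselves transposes, which
      also settles their dimension.\<close>
    by (rule finsum_vec_cong[OF _ _ t]) (simp_all only: t Pi_I transp_vec_carrier finite_Diff finite_knn)
  also have "\<dots> = feat_swap \<omega> (finsum_vec TYPE(real) (feat_dim \<omega>) (?t f (prod.swap \<omega>)) ?N)"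
    by (rule transp_vec_finsum[OF refl, symmetric]) (use t_carrier in \<open>simp_all only: Pi_I finite_Diff finite_knn\<close>)
  finally have sum: "finsum_vec TYPE(real) (feat_dim \<omega>) (?t (swap_field f) \<omega>) ?N =
      feat_swap \<omega> (finsum_vec TYPE(real) (feat_dim \<omega>) (?t f (prod.swap \<omega>)) ?N)" .
  have S_carrier: "?S f (prod.swap \<omega>) \<in> carrier_vec (feat_dim \<omega>)"
    using vec_mat_mult_carrier[OF feats_carrier[OF f u], of _ "prod.swap \<omega>"]
    by (simp only: feat_dim_swap zero_carrier_vec split: if_split) simp
  have sum_carrier: "finsum_vec TYPE(real) (feat_dim \<omega>) (?t f (prod.swap \<omega>)) ?N \<in> carrier_vec (feat_dim \<omega>)"
    by (intro finsum_vec_closed Pi_I t_carrier)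
  show ?thesis
    unfolding out_feat_def knn_swap_field[OF u] S sum feat_dim_swap[of \<omega>]
    using transp_vec_add[OF refl S_carrier sum_carrier] unfolding feat_dim_swap by (rule sym)
qed

lemma apply_transformer_swap:
  "apply_transformer Y C T (swap_field f) = swap_field (apply_transformer Y C T f)"
proof (rule nth_equalityI)
  show "length (apply_transformer Y C T (swap_field f)) = length (swap_field (apply_transformer Y C T f))"
    by (simp add: apply_transformer_def)
  fix u
  assume "u < length (apply_transformer Y C T (swap_field f))"
  then have u: "u < length f" by (simp add: apply_transformer_def)
  have "map (out_feat Y C T (swap_field f) u \<omega>) [0..<out_ch T \<omega>] =
      map (feat_swap \<omega>) (rows (mat_of_rows (feat_dim (prod.swap \<omega>))
        (map (out_feat Y C T f u (prod.swap \<omega>)) [0..<out_ch T (prod.swap \<omega>)])))" for \<omega>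
  proof -
    \<comment> \<open>Swapping the output field reads the channels back from the matrix just
      assembled; they have the right length, and there are as many in degree
      \<open>prod.swap \<omega>\<close> as in \<open>\<omega>\<close>.\<close>
    have "rows (mat_of_rows (feat_dim (prod.swap \<omega>))
        (map (out_feat Y C T f u (prod.swap \<omega>)) [0..<out_ch T (prod.swap \<omega>)])) =
        map (out_feat Y C T f u (prod.swap \<omega>)) [0..<out_ch T \<omega>]"
      unfolding channel_type_swap[OF out_ch]
      by (rule rows_mat_of_rows) (auto simp only: set_map intro: out_feat_carrier[OF u])
    \<comment> \<open>A degree with a channel \<open>a\<close> belongs to the degree set, so only
      the empty list is left when \<open>\<omega>\<close> is not an output degree.\<close>
    moreover have "\<omega> \<in> degs (out_ch T)" if "a < out_ch T \<omega>" for a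
      using that by (simp add: degs_def)
    ultimately show ?thesis
      using out_feat_swap[OF u] by simp
  qed
  then show "apply_transformer Y C T (swap_field f) ! u = swap_field (apply_transformer Y C T f) ! u"
    using u unfolding swap_field_eq[of "apply_transformer Y C T f"]
    by (simp add: apply_transformer_def pt_swap_field del: mult_Suc mult_Suc_right)
qed

end

section \<open>Equivariance of the Elu layer\<close>

lemma apply_elu_swap:
  assumes E: "elu_layer E"
    and nu: "\<And>\<iota>. \<iota> \<in> degs (elu_ch E) \<Longrightarrow> nu_wt E \<iota> = nu_wt E (prod.swap \<iota>)"
    and mu: "\<And>\<iota>. \<iota> \<in> degs (elu_ch E) \<Longrightarrow> mu_wt E \<iota> = mu_wt E (prod.swap \<iota>)"
    and f: "f \<in> tensor_fields (elu_ch E)"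
  shows "apply_elu E (swap_field f) = swap_field (apply_elu E f)"
proof -
  have ch: "channel_type (elu_ch E)" using E by (simp add: elu_layer_def)
  define out where "out F \<iota> a = elu_channel (row (mu_wt E \<iota> * F) a) (row (nu_wt E \<iota> * F) a)" for F \<iota> a
  have elu: "apply_elu E = map (\<lambda>(z, F). (z, \<lambda>\<iota>. mat_of_rows (feat_dim \<iota>) (map (out (F \<iota>) \<iota>) [0..<elu_ch E \<iota>])))"
    unfolding apply_elu_def out_def ..
  have "map (out (mat_of_rows (feat_dim \<iota>) (map (feat_swap \<iota>) (rows (F (prod.swap \<iota>))))) \<iota>) [0..<elu_ch E \<iota>] =
      map (feat_swap \<iota>) (rows (mat_of_rows (feat_dim (prod.swap \<iota>))
        (map (out (F (prod.swap \<iota>)) (prod.swap \<iota>)) [0..<elu_ch E (prod.swap \<iota>)])))"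
    if "(z, F) \<in> set f" for z F \<iota>
  proof -
    have F: "F (prod.swap \<iota>) \<in> carrier_mat (elu_ch E \<iota>) (feat_dim \<iota>)"
      using that f channel_type_swap[OF ch, of \<iota>] feat_dim_swap[of \<iota>]
      unfolding tensor_fields_def by (metis (mono_tags, lifting) case_prodD mem_Collect_eq)
    \<comment> \<open>The weights mix channels and so commute with transposition, as does the
      nonlinearity. The result involves the weights of \<open>\<iota>\<close> on one side and those
      of \<open>prod.swap \<iota>\<close> on the other, which \<open>mu\<close> and
      \<open>nu\<close> identify.\<close>
    have out: "out (F (prod.swap \<iota>)) (prod.swap \<iota>) a \<in> carrier_vec (feat_dim \<iota>) \<and>
        out (mat_of_rows (feat_dim \<iota>) (map (feat_swap \<iota>) (rows (F (prod.swap \<iota>))))) \<iota> a =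
        feat_swap \<iota> (out (F (prod.swap \<iota>)) (prod.swap \<iota>) a)" if a: "a < elu_ch E \<iota>" for a
    proof -
      have \<iota>: "\<iota> \<in> degs (elu_ch E)" using a by (simp add: degs_def)
      then have W: "mu_wt E \<iota> \<in> carrier_mat (elu_ch E \<iota>) (elu_ch E \<iota>)"
        "nu_wt E \<iota> \<in> carrier_mat (elu_ch E \<iota>) (elu_ch E \<iota>)"
        using E by (simp_all add: elu_layer_def)
      have r: "row (mu_wt E \<iota> * F (prod.swap \<iota>)) a \<in> carrier_vec (feat_dim \<iota>)"
        "row (nu_wt E \<iota> * F (prod.swap \<iota>)) a \<in> carrier_vec (feat_dim \<iota>)"
        using W F by (auto intro!: row_carrier_vec[OF a] mult_carrier_mat simp del: mult_Suc mult_Suc_right)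
      have "out (F (prod.swap \<iota>)) (prod.swap \<iota>) a \<in> carrier_vec (feat_dim \<iota>)"
        unfolding out_def mu[OF \<iota>, symmetric] nu[OF \<iota>, symmetric]
        by (rule elu_channel_carrier[OF r])
      moreover have "out (mat_of_rows (feat_dim \<iota>) (map (feat_swap \<iota>) (rows (F (prod.swap \<iota>))))) \<iota> a =
          feat_swap \<iota> (out (F (prod.swap \<iota>)) (prod.swap \<iota>) a)"
        unfolding out_def row_mult_transp_rows[OF refl F W(1) a] row_mult_transp_rows[OF refl F W(2) a]
          mu[OF \<iota>, symmetric] nu[OF \<iota>, symmetric]
        by (rule elu_channel_transp_vec[OF refl r])
      ultimately show ?thesis ..
    qed
    have "rows (mat_of_rows (feat_dim (prod.swap \<iota>))
        (map (out (F (prod.swap \<iota>)) (prod.swap \<iota>)) [0..<elu_ch E (prod.swap \<iota>)])) =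
        map (out (F (prod.swap \<iota>)) (prod.swap \<iota>)) [0..<elu_ch E \<iota>]"
      unfolding channel_type_swap[OF ch] feat_dim_swap
      by (rule rows_mat_of_rows) (use out in \<open>auto simp only: set_map set_upt atLeastLessThan_iff\<close>)
    then show ?thesis using out by simp
  qed
  then show ?thesis
    unfolding elu swap_field_eq by (auto simp del: mult_Suc mult_Suc_right)
qed

theorem proposition5p2:
  fixes \<rho> :: "nat \<Rightarrow> real^3^3 \<Rightarrow> real mat"
    and Y :: "nat \<Rightarrow> real^3 \<Rightarrow> real vec"
    and C :: "nat \<Rightarrow> nat \<Rightarrow> nat \<Rightarrow> real mat"
  assumes "SO3_irreps \<rho>" and "spherical_harmonics \<rho> Y" and "clebsch_gordan \<rho> C"
  shows
    "(\<forall>T. transformer_layer T \<and>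
        (\<forall>\<omega>\<in>degs (in_ch T) \<inter> degs (out_ch T). self_wt T \<omega> = self_wt T (prod.swap \<omega>)) \<and>
        (\<forall>\<omega>\<in>degs (in_ch T). query_wt T \<omega> = query_wt T (prod.swap \<omega>)) \<and>
        (\<forall>\<omega>\<in>degs (in_ch T). \<forall>\<iota>\<in>degs (in_ch T). \<forall>b<in_ch T \<iota>.
           \<forall>J\<^sub>1\<in>cg_range (fst \<omega>) (fst \<iota>). \<forall>J\<^sub>2\<in>cg_range (snd \<omega>) (snd \<iota>).
           \<forall>(z\<^sub>1::real^3) (z\<^sub>2::real^3).
             key_rad T \<omega> \<iota> b J\<^sub>1 J\<^sub>2 (norm z\<^sub>1) (norm z\<^sub>2) =
             key_rad T (prod.swap \<omega>) (prod.swap \<iota>) b J\<^sub>2 J\<^sub>1 (norm z\<^sub>2) (norm z\<^sub>1)) \<and>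
        (\<forall>\<omega>\<in>degs (out_ch T). \<forall>\<iota>\<in>degs (in_ch T). \<forall>a<out_ch T \<omega>. \<forall>b<in_ch T \<iota>.
           \<forall>J\<^sub>1\<in>cg_range (fst \<omega>) (fst \<iota>). \<forall>J\<^sub>2\<in>cg_range (snd \<omega>) (snd \<iota>).
           \<forall>(z\<^sub>1::real^3) (z\<^sub>2::real^3).
             val_rad T \<omega> \<iota> a b J\<^sub>1 J\<^sub>2 (norm z\<^sub>1) (norm z\<^sub>2) =
             val_rad T (prod.swap \<omega>) (prod.swap \<iota>) a b J\<^sub>2 J\<^sub>1 (norm z\<^sub>2) (norm z\<^sub>1))
      \<longrightarrow> (\<forall>f\<in>tensor_fields (in_ch T).
             apply_transformer Y C T (swap_field f) = swap_field (apply_transformer Y C T f)))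
     \<and>
     (\<forall>E. elu_layer E \<and>
        (\<forall>\<iota>\<in>degs (elu_ch E). nu_wt E \<iota> = nu_wt E (prod.swap \<iota>)) \<and>
        (\<forall>\<iota>\<in>degs (elu_ch E). mu_wt E \<iota> = mu_wt E (prod.swap \<iota>))
      \<longrightarrow> (\<forall>f\<in>tensor_fields (elu_ch E).
             apply_elu E (swap_field f) = swap_field (apply_elu E f)))"
proof (intro conjI allI impI ballI; elim conjE)
  fix T f
  assume *: "transformer_layer T" "f \<in> tensor_fields (in_ch T)"
    "\<forall>\<omega>\<in>degs (in_ch T) \<inter> degs (out_ch T). self_wt T \<omega> = self_wt T (prod.swap \<omega>)"
    "\<forall>\<omega>\<in>degs (in_ch T). query_wt T \<omega> = query_wt T (prod.swap \<omega>)"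
    "\<forall>\<omega>\<in>degs (in_ch T). \<forall>\<iota>\<in>degs (in_ch T). \<forall>b<in_ch T \<iota>.
       \<forall>J\<^sub>1\<in>cg_range (fst \<omega>) (fst \<iota>). \<forall>J\<^sub>2\<in>cg_range (snd \<omega>) (snd \<iota>).
       \<forall>(z\<^sub>1::real^3) (z\<^sub>2::real^3).
         key_rad T \<omega> \<iota> b J\<^sub>1 J\<^sub>2 (norm z\<^sub>1) (norm z\<^sub>2) =
         key_rad T (prod.swap \<omega>) (prod.swap \<iota>) b J\<^sub>2 J\<^sub>1 (norm z\<^sub>2) (norm z\<^sub>1)"
    "\<forall>\<omega>\<in>degs (out_ch T). \<forall>\<iota>\<in>degs (in_ch T). \<forall>a<out_ch T \<omega>. \<forall>b<in_ch T \<iota>.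
       \<forall>J\<^sub>1\<in>cg_range (fst \<omega>) (fst \<iota>). \<forall>J\<^sub>2\<in>cg_range (snd \<omega>) (snd \<iota>).
       \<forall>(z\<^sub>1::real^3) (z\<^sub>2::real^3).
         val_rad T \<omega> \<iota> a b J\<^sub>1 J\<^sub>2 (norm z\<^sub>1) (norm z\<^sub>2) =
         val_rad T (prod.swap \<omega>) (prod.swap \<iota>) a b J\<^sub>2 J\<^sub>1 (norm z\<^sub>2) (norm z\<^sub>1)"
  show "apply_transformer Y C T (swap_field f) = swap_field (apply_transformer Y C T f)"
    \<comment> \<open>The representation \<open>\<rho>\<close> occurs in the locale assumptions but
      not in the conclusion, so unification cannot find it.\<close>
    by (rule swap_symmetric_transformer.apply_transformer_swap[of \<rho>], unfold_locales)
      (use assms(2) * in blast)+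
next
  fix E f
  assume "elu_layer E" "f \<in> tensor_fields (elu_ch E)"
    "\<forall>\<iota>\<in>degs (elu_ch E). nu_wt E \<iota> = nu_wt E (prod.swap \<iota>)"
    "\<forall>\<iota>\<in>degs (elu_ch E). mu_wt E \<iota> = mu_wt E (prod.swap \<iota>)"
  then show "apply_elu E (swap_field f) = swap_field (apply_elu E f)"
    by (intro apply_elu_swap) blast+
qed

end
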